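(* Let $\pi\colon \mathrm{GL}(n)\to \mathrm{GL}(V)$ be a rational representation on a finite-dimensional complex vector space $V$ with a $U(n)$-invariant Hermitian inner product, let $v\in V$ with $\operatorname{cap}(v)>0$, let $\varepsilon>0$, and let $g\in \mathrm{GL}(n)$. (1) If $\log\|\pi(g)v\|-\log\operatorname{cap}(v)\le\varepsilon$, then $\|\mu(\pi(g)v)\|_F\le N(\pi)\sqrt{8\varepsilon}$. (That is, a valid output for the norm minimization problem on input $(\pi,v,\varepsilon)$ is a valid output for the scaling problem on input $(\pi,v,N(\pi)\sqrt{8\varepsilon})$.) (2) If $\varepsilon/\gamma(\pi)<\tfrac12$ and $\|\mu(\pi(g)v)\|_F\le\varepsilon$, then $\log\|\pi(g)v\|-\log\operatorname{cap}(v)\le \frac{2\log(2)\,\varepsilon}{\gamma(\pi)}$. (That is, a valid output for the scaling problem on input $(\pi,v,\varepsilon)$ is a valid output for the norm minimization problem on input $(\pi,v,2\log(2)\varepsilon/\gamma(\pi))$.)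
   Context: $\log$ is the natural logarithm. Rational representation: a group homomorphism whose matrix entries are polynomials in the $g_{i,j}$ and $\det(g)^{-1}$; the inner product is such that $\pi(U(n))$ acts by unitary maps, and $\|\cdot\|$ is its norm. $\|\cdot\|_F$ is the Frobenius norm. Capacity: $\operatorname{cap}(v)=\inf_{g\in \mathrm{GL}(n)}\|\pi(g)v\|$. (By the Kempf–Ness theorem $\operatorname{cap}(v)>0$ is equivalent to $0\in\Delta(v)$, where $\Delta(v)$ is the moment polytope, the closure of $\{\operatorname{spec}(\mu(w)):w\in\pi(\mathrm{GL}(n))v\}$.) Moment map: $\mu\colon V\setminus\{0\}\to \mathrm{Herm}(n)$ is defined by $\operatorname{tr}[\mu(v)H]=\partial_{t=0}\log\|\pi(e^{tH})v\|$ for all Hermitian $H$. Scaling problem: given $(\pi,v,\varepsilon)$ with $0\in\Delta(v)$, output $g$ with $\|\mu(\pi(g)v)\|_F\le\varepsilon$. Norm minimization problem: given $(\pi,v,\varepsilon)$ with $\operatorname{cap}(v)>0$, output $g$ with $\log\|\pi(g)v\|-\log\operatorname{cap}(v)\le\varepsilon$. Weights: $\Omega(\pi)\subset\mathbb Z^n$ is the set of $\omega$ such that there is a nonzero $w\in V$ with $\pi(\operatorname{diag}(x))w=\prod_i x_i^{\omega_i}w$ for all invertible diagonal matrices. Weight norm: $N(\pi)$ is the maximum of $\|\lambda\|_2$ over the highest weights $\lambda$ of irreducible subrepresentations of $\pi$. Weight margin: $\gamma(\pi)$ is the minimum Euclidean distance from the origin to $\operatorname{conv}(\Gamma)$ over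 nonempty $\Gamma\subseteq\Omega(\pi)$ with $0\notin\operatorname{conv}(\Gamma)$ (and $+\infty$ if there is none). *)

theory Defs
  imports "HOL-Analysis.Analysis"
begin

definition cadjoint :: "complex^'n^'n \<Rightarrow> complex^'n^'n" where
  "cadjoint A = (\<chi> i j. cnj (A $ j $ i))"

definition hermitian_matrix :: "complex^'n^'n \<Rightarrow> bool" where
  "hermitian_matrix A \<longleftrightarrow> cadjoint A = A"

definition unitary_matrix :: "complex^'n^'n \<Rightarrow> bool" where
  "unitary_matrix U \<longleftrightarrow> cadjoint U ** U = mat 1 \<and> U ** cadjoint U = mat 1"

definition frobenius_norm :: "complex^'n^'n \<Rightarrow> real" where
  "frobenius_norm A = sqrt (\<Sum>i\<in>UNIV. \<Sum>j\<in>UNIV. (cmod (A $ i $ j))\<^sup>2)"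

definition diag_matrix :: "complex^'n \<Rightarrow> complex^'n^'n" where
  "diag_matrix x = (\<chi> i j. if i = j then x $ i else 0)"

text \<open>The matrix type is not an instance of the normed algebra classes, so the library
  exponential does not apply to it.\<close>
definition matrix_exp :: "complex^'n^'n \<Rightarrow> complex^'n^'n" where
  "matrix_exp A = (\<Sum>k. inverse (fact k) *\<^sub>R (((**) A ^^ k) (mat 1)))"

text \<open>Polynomials in the matrix entries and the inverse of the determinant, as functions.\<close>
inductive rational_fun :: "(complex^'n^'n \<Rightarrow> complex) \<Rightarrow> bool" where
  const: "rational_fun (\<lambda>g. c)"
| entry: "rational_fun (\<lambda>g. g $ i $ j)"
| inv_det: "rational_fun (\<lambda>g. inverse (det g))"
| add: "rational_fun p \<Longrightarrow> rational_fun q \<Longrightarrow> rational_fun (\<lambda>g. p g + q g)"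
| mult: "rational_fun p \<Longrightarrow> rational_fun q \<Longrightarrow> rational_fun (\<lambda>g. p g * q g)"

text \<open>The vector space is the whole type \<open>'v\<close>. The locale
  \<open>finite_dimensional_vector_space\<close> comes with a finite basis \<open>B\<close>; rationality
  of a representation does not depend on its choice. A representation is a function on
  all matrices, of which only the values on invertible ones are ever used.\<close>
locale rational_unitary_rep =
  finite_dimensional_vector_space smul B
  for smul :: "complex \<Rightarrow> 'v::ab_group_add \<Rightarrow> 'v" and B :: "'v set" +
  fixes ip :: "'v \<Rightarrow> 'v \<Rightarrow> complex"
    and \<pi> :: "complex^'n::finite^'n \<Rightarrow> 'v \<Rightarrow> 'v"
  assumes ip_add_right: "ip x (y + z) = ip x y + ip x z"
    and ip_scale_right: "ip x (smul a y) = a * ip x y"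
    and ip_commute: "ip y x = cnj (ip x y)"
    and ip_pos: "x \<noteq> 0 \<Longrightarrow> Re (ip x x) > 0"
    and rep_linear: "invertible g \<Longrightarrow> Vector_Spaces.linear smul smul (\<pi> g)"
    and rep_one: "\<pi> (mat 1) = id"
    and rep_mult: "invertible g \<Longrightarrow> invertible h \<Longrightarrow> \<pi> (g ** h) = \<pi> g \<circ> \<pi> h"
    and rep_rational: "b \<in> B \<Longrightarrow> c \<in> B \<Longrightarrow>
      \<exists>p. rational_fun p \<and> (\<forall>g. invertible g \<longrightarrow> representation B (\<pi> g b) c = p g)"
    and rep_unitary: "unitary_matrix u \<Longrightarrow> ip (\<pi> u x) (\<pi> u y) = ip x y"

definition ip_norm :: "('v \<Rightarrow> 'v \<Rightarrow> complex) \<Rightarrow> 'v \<Rightarrow> real" where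
  "ip_norm ip x = sqrt (Re (ip x x))"

definition capacity ::
  "('v \<Rightarrow> 'v \<Rightarrow> complex) \<Rightarrow> (complex^'n^'n \<Rightarrow> 'v \<Rightarrow> 'v) \<Rightarrow> 'v \<Rightarrow> real" where
  "capacity ip \<pi> v = (INF g\<in>{g. invertible g}. ip_norm ip (\<pi> g v))"

text \<open>Meaningful for \<open>v \<noteq> 0\<close> only. The derivative is taken in the complex plane merely
  because the trace is a complex number; its value is real.\<close>
definition moment_map ::
  "('v \<Rightarrow> 'v \<Rightarrow> complex) \<Rightarrow> (complex^'n^'n \<Rightarrow> 'v \<Rightarrow> 'v) \<Rightarrow> 'v \<Rightarrow> complex^'n^'n" where
  "moment_map ip \<pi> v = (THE M. hermitian_matrix M \<and>
     (\<forall>H. hermitian_matrix H \<longrightarrow>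
       ((\<lambda>t::real. complex_of_real (ln (ip_norm ip (\<pi> (matrix_exp (t *\<^sub>R H)) v))))
          has_vector_derivative trace (M ** H)) (at 0)))"

definition real_vec :: "int^'n \<Rightarrow> real^'n" where
  "real_vec \<omega> = (\<chi> i. real_of_int (\<omega> $ i))"

definition weights ::
  "(complex \<Rightarrow> 'v::zero \<Rightarrow> 'v) \<Rightarrow> (complex^'n^'n \<Rightarrow> 'v \<Rightarrow> 'v) \<Rightarrow> (int^'n) set" where
  "weights smul \<pi> = {\<omega>. \<exists>w. w \<noteq> 0 \<and>
     (\<forall>x. (\<forall>i. x $ i \<noteq> 0) \<longrightarrow>
       \<pi> (diag_matrix x) w = smul (\<Prod>i\<in>UNIV. (x $ i) powi (\<omega> $ i)) w)}"

definition subrep ::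
  "(complex \<Rightarrow> 'v::ab_group_add \<Rightarrow> 'v) \<Rightarrow> (complex^'n^'n \<Rightarrow> 'v \<Rightarrow> 'v) \<Rightarrow> 'v set \<Rightarrow> bool" where
  "subrep smul \<pi> W \<longleftrightarrow>
     module.subspace smul W \<and> (\<forall>g. invertible g \<longrightarrow> \<pi> g ` W \<subseteq> W)"

definition irreducible_subrep ::
  "(complex \<Rightarrow> 'v::ab_group_add \<Rightarrow> 'v) \<Rightarrow> (complex^'n^'n \<Rightarrow> 'v \<Rightarrow> 'v) \<Rightarrow> 'v set \<Rightarrow> bool" where
  "irreducible_subrep smul \<pi> W \<longleftrightarrow> subrep smul \<pi> W \<and> W \<noteq> {0} \<and>
     (\<forall>U. subrep smul \<pi> U \<and> U \<subseteq> W \<longrightarrow> U = {0} \<or> U = W)"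

definition upper_triangular_matrix :: "complex^'n::{finite,wellorder}^'n::_ \<Rightarrow> bool" where
  "upper_triangular_matrix b \<longleftrightarrow> (\<forall>i j. j < i \<longrightarrow> b $ i $ j = 0)"

text \<open>The weight of a highest weight vector: an eigenvector of the Borel subgroup of
  invertible upper triangular matrices.\<close>
definition is_highest_weight ::
  "(complex \<Rightarrow> 'v::ab_group_add \<Rightarrow> 'v) \<Rightarrow> (complex^'n::{finite,wellorder}^'n::_ \<Rightarrow> 'v \<Rightarrow> 'v)
     \<Rightarrow> 'v set \<Rightarrow> int^'n::_ \<Rightarrow> bool" where
  "is_highest_weight smul \<pi> W l \<longleftrightarrow> (\<exists>w\<in>W. w \<noteq> 0 \<and>
     (\<forall>b. invertible b \<and> upper_triangular_matrix b \<longrightarrow>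
       \<pi> b w = smul (\<Prod>i\<in>UNIV. (b $ i $ i) powi (l $ i)) w))"

definition weight_norm ::
  "(complex \<Rightarrow> 'v::ab_group_add \<Rightarrow> 'v) \<Rightarrow> (complex^'n::{finite,wellorder}^'n::_ \<Rightarrow> 'v \<Rightarrow> 'v)
     \<Rightarrow> real" where
  "weight_norm smul \<pi> =
     Max {norm (real_vec l) | l W. irreducible_subrep smul \<pi> W \<and> is_highest_weight smul \<pi> W l}"

text \<open>There are finitely many weights, hence the infimum is a minimum unless the family is
  empty, in which case it is \<open>\<infinity>\<close>.\<close>
definition weight_margin ::
  "(complex \<Rightarrow> 'v::zero \<Rightarrow> 'v) \<Rightarrow> (complex^'n^'n \<Rightarrow> 'v \<Rightarrow> 'v) \<Rightarrow> ereal" where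
  "weight_margin smul \<pi> =
     (INF \<Gamma>\<in>{\<Gamma>. \<Gamma> \<noteq> {} \<and> \<Gamma> \<subseteq> weights smul \<pi> \<and> 0 \<notin> convex hull (real_vec ` \<Gamma>)}.
        ereal (infdist 0 (convex hull (real_vec ` \<Gamma>))))"

end

theory Submission
  imports Defs
begin

text \<open>
  The theorem follows from two inequalities between the capacity and the moment map. Write
  \<open>\<mu>\<close> for the moment map at a nonzero vector \<open>w\<close>, \<open>N\<close> for the weight norm, \<open>\<gamma>\<close> for the weight
  margin and \<open>c\<close> for the capacity. Then
  \<open>1 - |\<mu>| / \<gamma> \<le> c\<^sup>2 / |w|\<^sup>2 \<le> 1 - |\<mu>|\<^sup>2 / (4 N\<^sup>2)\<close>
  (if \<open>N = 0\<close>, then \<open>\<mu> = 0\<close>), and both parts of the theorem result by taking logarithms.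

  Both inequalities reduce to sums of exponentials. The space is the orthogonal sum of its weight
  spaces, so a positive diagonal matrix \<open>exp(diag(x))\<close> multiplies the squared norm of \<open>w\<close> by
  \<open>\<Sum> p(\<omega>) exp(2 \<omega> \<bullet> x)\<close>, where \<open>p(\<omega>)\<close> is the share of the weight \<open>\<omega>\<close> in the squared norm. The
  derivative at 0 is twice the mean of \<open>\<omega> \<bullet> x\<close>, so the mean weight is the diagonal of \<open>\<mu>\<close>. Every
  invertible matrix is a product of a unitary, a positive diagonal and a unitary matrix
  (\<open>invertible_polar_diag\<close>), and unitary matrices preserve norms.

  For the upper bound, move in the direction \<open>- \<mu>\<close> (\<open>moment_map_steepest_descent\<close>). There the
  exponents are at most \<open>N |\<mu>|\<close>, provided that \<open>N\<close> bounds the norms of all weights and not only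
  of highest ones. This is \<open>weight_norm_bound\<close>: up to a permutation of the coordinates, a weight
  of maximal norm is a highest weight, because for a suitable one-parameter subgroup it is the
  unique extreme weight, and contracting upper triangular matrices along this subgroup shows that
  its weight vectors are eigenvectors of the Borel subgroup.

  For the lower bound, split the distribution \<open>p\<close> into a part with mean 0 and a remainder whose
  support has a convex hull without 0 (\<open>exponential_sum_lower_bound\<close>). By convexity the exponential
  sum of the first part is at least its mass. The mass of the remainder is at most \<open>|\<mu>| / \<gamma>\<close>, since
  its normalized mean has norm at least \<open>\<gamma>\<close> by the definition of the margin.

  That the moment map exists at all rests on the linearity of the derivative in the direction,
  which comes from the rationality of the representation (\<open>moment_map_unique\<close>).
\<close>

section \<open>Diagonalization of Hermitian matrices and the polar decomposition\<close>

text \<open>The Hermitian form whose real part is the inner product of the type class.\<close>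
definition cip :: "complex^'n \<Rightarrow> complex^'n \<Rightarrow> complex" where
  "cip x y = (\<Sum>i\<in>UNIV. cnj (x $ i) * y $ i)"

lemma cip_add: "cip x (y + z) = cip x y + cip x z" "cip (x + y) z = cip x z + cip y z"
  by (simp_all add: cip_def algebra_simps sum.distrib)

lemma cip_diff: "cip x (y - z) = cip x y - cip x z"
  by (simp add: cip_def algebra_simps sum_subtractf)

lemma cip_scale: "cip x (c *s y) = c * cip x y" "cip (c *s x) y = cnj c * cip x y"
  by (simp_all add: cip_def algebra_simps sum_distrib_left)

lemma cip_scaleR: "cip x (r *\<^sub>R y) = of_real r * cip x y" "cip (r *\<^sub>R x) y = of_real r * cip x y"
  by (simp_all add: cip_def algebra_simps sum_distrib_left scaleR_conv_of_real[where 'a=complex])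

lemma cip_commute: "cip y x = cnj (cip x y)"
  by (simp add: cip_def mult.commute)

lemma cip_sum_right: "cip x (\<Sum>a\<in>A. f a) = (\<Sum>a\<in>A. cip x (f a))"
  unfolding cip_def by (simp add: sum_distrib_left) (rule sum.swap)

lemma Re_cip: "Re (cip x y) = x \<bullet> y"
  by (simp add: cip_def inner_vec_def inner_complex_def)

lemma cip_self: "cip x x = of_real ((norm x)\<^sup>2)"
proof -
  have "Im (cip x x) = 0" by (simp add: cip_def mult.commute)
  moreover have "Re (cip x x) = (norm x)\<^sup>2" by (simp add: Re_cip power2_norm_eq_inner)
  ultimately show ?thesis by (simp add: complex_eq_iff)
qed

lemma cip_matrix: "cip x (A *v y) = cip (cadjoint A *v x) y"
  unfolding cip_def matrix_vector_mult_def cadjoint_def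
  by (simp add: sum_distrib_left sum_distrib_right algebra_simps) (rule sum.swap)

lemma continuous_on_cip [continuous_intros]:
  "continuous_on S f \<Longrightarrow> continuous_on S g \<Longrightarrow> continuous_on S (\<lambda>x. cip (f x) (g x))"
  unfolding cip_def by (intro continuous_intros)

lemma cadjoint_nth [simp]: "cadjoint A $ i $ j = cnj (A $ j $ i)"
  by (simp add: cadjoint_def)

lemma diag_matrix_nth [simp]: "diag_matrix x $ i $ j = (if i = j then x $ i else 0)"
  by (simp add: diag_matrix_def)

lemma cadjoint_cadjoint [simp]: "cadjoint (cadjoint A) = A"
  by (simp add: vec_eq_iff)

lemma cadjoint_mult: "cadjoint (A ** B) = cadjoint B ** cadjoint A"
  by (simp add: vec_eq_iff matrix_matrix_mult_def mult.commute)

lemma cadjoint_one [simp]: "cadjoint (mat 1) = mat 1"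
  by (auto simp add: vec_eq_iff mat_def)

lemma scaleR_matrix_vector: "(A::complex^'n^'n) *v (r *\<^sub>R x) = r *\<^sub>R (A *v x)"
  by (simp add: vec_eq_iff matrix_vector_mult_def scaleR_sum_right)

text \<open>Fewer than \<open>CARD('n)\<close> vectors do not span the space; a vector outside their span
  minus its projection is orthogonal to them and nonzero.\<close>
lemma exists_orthogonal_vector:
  fixes f :: "'n::finite \<Rightarrow> complex^'n"
  assumes "A \<noteq> UNIV" and orth: "\<And>a b. a \<in> A \<Longrightarrow> b \<in> A \<Longrightarrow> cip (f a) (f b) = (if a = b then 1 else 0)"
  shows "\<exists>x. x \<noteq> 0 \<and> (\<forall>a\<in>A. cip (f a) x = 0)"
proof -
  have "vec.dim (vec.span (f ` A)) \<le> card (f ` A)"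
    by (simp add: vec.dim_le_card')
  also have "\<dots> \<le> card A" by (simp add: card_image_le)
  also have "\<dots> < CARD('n)" using assms(1) by (simp add: psubset_card_mono psubsetI)
  finally have "vec.span (f ` A) \<noteq> UNIV" 
    by (metis vec.dim_UNIV less_irrefl vec.dimension_def card_cart_basis)
  then obtain x where x: "x \<notin> vec.span (f ` A)" by blast
  define y where "y = x - (\<Sum>a\<in>A. cip (f a) x *s f a)"
  have "(\<Sum>a\<in>A. cip (f a) x *s f a) \<in> vec.span (f ` A)"
    by (intro vec.span_sum vec.span_scale vec.span_base) auto
  then have "y \<noteq> 0" using x by (auto simp: y_def)
  moreover have "cip (f a) y = 0" if "a \<in> A" for a
  proof -
    have "cip (f a) (\<Sum>b\<in>A. cip (f b) x *s f b) = (\<Sum>b\<in>A. if b = a then cip (f a) x else 0)"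
      unfolding cip_sum_right cip_scale by (rule sum.cong) (use orth that in auto)
    then show ?thesis using that by (simp add: y_def cip_diff)
  qed
  ultimately show ?thesis by blast
qed

text \<open>A maximizer \<open>x\<close> of the quadratic form of \<open>H\<close> on the unit sphere of the orthogonal
  complement is an eigenvector. The complement of a set of eigenvectors is invariant under \<open>H\<close>,
  so it contains the residual \<open>r = H x - l x\<close>, and a step of length \<open>s\<close> from \<open>x\<close> towards \<open>r\<close>
  would gain \<open>2 s |r|\<^sup>2\<close> to first order; maximality allows a gain of order \<open>s\<^sup>2\<close> only.\<close>
lemma hermitian_eigenvector_orthogonal:
  fixes H :: "complex^'n::finite^'n" and f :: "'n \<Rightarrow> complex^'n"
  assumes H: "hermitian_matrix H" and "A \<noteq> UNIV"
    and orth: "\<And>a b. a \<in> A \<Longrightarrow> b \<in> A \<Longrightarrow> cip (f a) (f b) = (if a = b then 1 else 0)"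
    and eig: "\<And>a. a \<in> A \<Longrightarrow> H *v f a = (d a :: real) *\<^sub>R f a"
  shows "\<exists>x l::real. norm x = 1 \<and> (\<forall>a\<in>A. cip (f a) x = 0) \<and> H *v x = l *\<^sub>R x"
proof -
  define K where "K = {x. norm x = 1 \<and> (\<forall>a\<in>A. cip (f a) x = 0)}"
  have K: "K = sphere 0 1 \<inter> (\<Inter>a\<in>A. {x. cip (f a) x = 0})"
    by (auto simp: K_def)
  have "closed {x. cip (f a) x = 0}" for a
    by (intro closed_Collect_eq continuous_intros)
  then have "compact K" unfolding K by (intro compact_Int_closed closed_INT) auto
  obtain y where y: "y \<noteq> 0" "\<forall>a\<in>A. cip (f a) y = 0"
    using exists_orthogonal_vector[OF assms(2) orth] by blast
  then have "(1 / norm y) *\<^sub>R y \<in> K" by (auto simp: K_def cip_scaleR)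
  then have "K \<noteq> {}" by blast
  define \<phi> where "\<phi> x = x \<bullet> (H *v x)" for x
  have "continuous_on K \<phi>" unfolding \<phi>_def
    by (intro continuous_intros matrix_vector_mult_linear_continuous_on)
  then obtain x where xK: "x \<in> K" and max: "\<forall>z\<in>K. \<phi> z \<le> \<phi> x"
    using continuous_attains_sup[OF \<open>compact K\<close> \<open>K \<noteq> {}\<close>] by blast
  have H2: "u \<bullet> (H *v w) = (H *v u) \<bullet> w" for u w
    using H unfolding hermitian_matrix_def Re_cip[symmetric] by (simp add: cip_matrix)
  define l where "l = \<phi> x"
  define r where "r = H *v x - l *\<^sub>R x"
  have bound: "\<phi> z \<le> l * (norm z)\<^sup>2" if "\<forall>a\<in>A. cip (f a) z = 0" for z
  proof (cases "z = 0")
    case False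
    with that have "(1 / norm z) *\<^sub>R z \<in> K" by (auto simp: K_def cip_scaleR)
    then have "\<phi> ((1 / norm z) *\<^sub>R z) \<le> l" using max l_def by blast
    moreover have "\<phi> ((1 / norm z) *\<^sub>R z) = \<phi> z / (norm z)\<^sup>2"
      by (simp add: \<phi>_def scaleR_matrix_vector power2_eq_square)
    ultimately show ?thesis using False by (simp add: field_simps)
  qed (simp add: \<phi>_def)
  have x0: "\<forall>a\<in>A. cip (f a) x = 0" and nx: "norm x = 1" using xK by (auto simp: K_def)
  have r0: "\<forall>a\<in>A. cip (f a) r = 0"
  proof
    fix a assume a: "a \<in> A"
    have "cip (f a) (H *v x) = cip (H *v f a) x"
      using H by (simp add: cip_matrix hermitian_matrix_def)
    then show "cip (f a) r = 0" using a eig x0 by (simp add: r_def cip_diff cip_scaleR)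
  qed
  define C where "C = l * (norm r)\<^sup>2 - \<phi> r"
  have step: "2 * (norm r)\<^sup>2 \<le> s * C" if "s > 0" for s :: real
  proof -
    have "\<phi> (x + s *\<^sub>R r) \<le> l * (norm (x + s *\<^sub>R r))\<^sup>2"
      by (rule bound) (use x0 r0 in \<open>simp add: cip_add cip_scaleR\<close>)
    also have "\<phi> (x + s *\<^sub>R r) = l + 2 * s * (r \<bullet> (H *v x)) + s\<^sup>2 * \<phi> r"
    proof -
      have "x \<bullet> (H *v r) = r \<bullet> (H *v x)" by (subst H2) (rule inner_commute)
      then show ?thesis unfolding \<phi>_def l_def
        by (simp add: matrix_vector_right_distrib scaleR_matrix_vector algebra_simps power2_eq_square)
    qed
    also have "(norm (x + s *\<^sub>R r))\<^sup>2 = 1 + 2 * s * (r \<bullet> x) + s\<^sup>2 * (norm r)\<^sup>2"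
      using nx unfolding power2_norm_eq_inner norm_eq_1
      by (simp add: inner_add inner_commute power2_eq_square del: dot_square_norm)
    finally have "2 * s * (r \<bullet> (H *v x - l *\<^sub>R x)) \<le> s\<^sup>2 * C"
      by (simp add: C_def algebra_simps)
    then have "s * (2 * (r \<bullet> r)) \<le> s * (s * C)"
      unfolding r_def[symmetric] power2_eq_square by (simp only: mult.assoc mult.left_commute)
    then have "2 * (r \<bullet> r) \<le> s * C" using that by (simp only: mult_le_cancel_left_pos)
    then show ?thesis by (simp only: power2_norm_eq_inner)
  qed
  have "(norm r)\<^sup>2 = 0"
  proof (rule ccontr)
    assume "(norm r)\<^sup>2 \<noteq> 0"
    then have pos: "(norm r)\<^sup>2 > 0" by simp
    then have C: "C > 0" using step[of 1] by linarith
    have "2 * (norm r)\<^sup>2 \<le> (norm r)\<^sup>2 / C * C" using pos C by (intro step divide_pos_pos)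
    also have "\<dots> = (norm r)\<^sup>2" using C by simp
    finally have "2 * (norm r)\<^sup>2 \<le> (norm r)\<^sup>2" .
    with pos show False by simp
  qed
  then have "H *v x = l *\<^sub>R x" by (simp add: r_def)
  with nx x0 show ?thesis by blast
qed

text \<open>Induction on sets of indices rather than on the dimension keeps all vectors in one type.\<close>
lemma hermitian_orthonormal_eigenvectors:
  fixes H :: "complex^'n::finite^'n"
  assumes H: "hermitian_matrix H" and "finite A"
  shows "\<exists>f (d::'n \<Rightarrow> real). (\<forall>a\<in>A. \<forall>b\<in>A. cip (f a) (f b) = (if a = b then 1 else 0)) \<and>
     (\<forall>a\<in>A. H *v f a = d a *\<^sub>R f a)"
  using \<open>finite A\<close>
proof (induction A rule: finite_induct)
  case (insert a A)
  then obtain f and d :: "'n \<Rightarrow> real" where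
    f: "\<And>a b. a \<in> A \<Longrightarrow> b \<in> A \<Longrightarrow> cip (f a) (f b) = (if a = b then 1 else 0)"
    and d: "\<And>a. a \<in> A \<Longrightarrow> H *v f a = d a *\<^sub>R f a" by blast
  have "A \<noteq> UNIV" using insert by blast
  from hermitian_eigenvector_orthogonal[OF H this f d] obtain x l where
    x: "norm x = 1" "\<forall>a\<in>A. cip (f a) x = 0" "H *v x = l *\<^sub>R x" by blast
  moreover have "cip x x = 1" using x(1) by (simp add: cip_self)
  moreover have "\<forall>b\<in>A. cip x (f b) = 0"
  proof
    fix b assume "b \<in> A"
    with x(2) have "cip (f b) x = 0" by blast
    then show "cip x (f b) = 0" by (subst cip_commute) simp
  qed
  ultimately show ?case using f d insert.hyps
    by (intro exI[of _ "f(a := x)"] exI[of _ "d(a := l)"]) auto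
qed simp

definition real_diag :: "real^'n \<Rightarrow> complex^'n^'n" where
  "real_diag x = diag_matrix (\<chi> i. complex_of_real (x $ i))"

lemma real_diag_nth [simp]: "real_diag x $ i $ j = (if i = j then complex_of_real (x $ i) else 0)"
  by (simp add: real_diag_def)

lemma diag_matrix_mult: "diag_matrix x ** diag_matrix y = diag_matrix (\<chi> i. x $ i * y $ i)"
  by (simp add: vec_eq_iff matrix_matrix_mult_def if_distrib[of "\<lambda>y. _ * y"] cong: if_cong)

lemma diag_matrix_one: "diag_matrix (\<chi> i. 1) = mat 1"
  by (simp add: vec_eq_iff mat_def)

lemma real_diag_mult: "real_diag x ** real_diag y = real_diag (\<chi> i. x $ i * y $ i)"
  by (simp add: real_diag_def diag_matrix_mult)

lemma real_diag_one: "real_diag (\<chi> i. 1) = mat 1"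
  by (simp add: vec_eq_iff mat_def)

lemma cadjoint_real_diag [simp]: "cadjoint (real_diag x) = real_diag x"
  by (simp add: vec_eq_iff)

theorem hermitian_spectral:
  fixes H :: "complex^'n::finite^'n"
  assumes H: "hermitian_matrix H"
  obtains U x where "unitary_matrix U" "H = U ** real_diag x ** cadjoint U"
proof -
  obtain f and d :: "'n \<Rightarrow> real" where
    f: "\<And>a b. cip (f a) (f b) = (if a = b then 1 else 0)"
    and d: "\<And>a. H *v f a = d a *\<^sub>R f a"
    using hermitian_orthonormal_eigenvectors[OF H, of UNIV] by auto
  define U where "U = (\<chi> i j. f j $ i)"
  have 1: "cadjoint U ** U = mat 1"
    using f by (simp add: vec_eq_iff U_def matrix_matrix_mult_def mat_def cip_def)
  then have 2: "U ** cadjoint U = mat 1" by (simp add: matrix_left_right_inverse)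
  have "H ** U = U ** real_diag (\<chi> i. d i)"
  proof -
    have "(H ** U) $ i $ j = (U ** real_diag (\<chi> i. d i)) $ i $ j" for i j
    proof -
      have "(H ** U) $ i $ j = (H *v f j) $ i"
        by (simp add: U_def matrix_matrix_mult_def matrix_vector_mult_def)
      also have "\<dots> = d j *\<^sub>R f j $ i" by (simp add: d)
      also have "\<dots> = (\<Sum>k\<in>UNIV. if k = j then of_real (d j) * f j $ i else 0)"
        by (simp add: scaleR_conv_of_real)
      also have "\<dots> = (U ** real_diag (\<chi> i. d i)) $ i $ j"
        unfolding matrix_matrix_mult_def U_def vec_lambda_beta real_diag_nth
        by (rule sum.cong) auto
      finally show ?thesis .
    qed
    then show ?thesis by (simp add: vec_eq_iff)
  qed
  then have "H = U ** real_diag (\<chi> i. d i) ** cadjoint U"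
    by (metis 2 matrix_mul_assoc matrix_mul_rid)
  then show ?thesis using 1 2 that unfolding unitary_matrix_def by blast
qed

lemma unitary_invertible: "unitary_matrix U \<Longrightarrow> invertible U"
  unfolding unitary_matrix_def invertible_def by blast

lemma unitary_cadjoint [simp]: "unitary_matrix (cadjoint U) \<longleftrightarrow> unitary_matrix U"
  by (auto simp: unitary_matrix_def)

lemma invertible_cadjoint:
  assumes "invertible A" shows "invertible (cadjoint A)"
proof -
  obtain C where "A ** C = mat 1" "C ** A = mat 1" using assms invertible_def by blast
  then have "cadjoint C ** cadjoint A = mat 1" "cadjoint A ** cadjoint C = mat 1"
    by (simp_all flip: cadjoint_mult)
  then show ?thesis unfolding invertible_def by blast
qed

definition exp_diag :: "real^'n \<Rightarrow> complex^'n^'n" where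
  "exp_diag x = real_diag (\<chi> i. exp (x $ i))"

lemma exp_diag_add: "exp_diag x ** exp_diag y = exp_diag (x + y)"
  by (simp add: exp_diag_def real_diag_mult exp_add)

lemma exp_diag_zero [simp]: "exp_diag 0 = mat 1"
  using real_diag_one by (simp add: exp_diag_def)

lemma cadjoint_exp_diag [simp]: "cadjoint (exp_diag x) = exp_diag x"
  by (simp add: exp_diag_def)

lemma exp_diag_inverse: "exp_diag (-x) ** exp_diag x = mat 1" "exp_diag x ** exp_diag (-x) = mat 1"
  by (simp_all add: exp_diag_add)

lemma invertible_exp_diag [simp]: "invertible (exp_diag x)"
  using exp_diag_inverse unfolding invertible_def by blast

text \<open>If \<open>g\<^sup>* g = U diag(x) U\<^sup>*\<close>, then \<open>x\<^sub>i\<close> is the squared norm of the \<open>i\<close>-th column of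
  \<open>g U\<close>, hence positive, and \<open>g U diag(1 / sqrt x)\<close> is unitary. Unitary factors change
  neither the norm of a vector nor that of its moment map, so this decomposition reduces
  norms along an orbit of \<open>GL(n)\<close> to the action of positive diagonal matrices.\<close>
theorem invertible_polar_diag:
  fixes g :: "complex^'n::finite^'n"
  assumes g: "invertible g"
  obtains k x l where "unitary_matrix k" "unitary_matrix l" "g = k ** exp_diag x ** l"
proof -
  have "hermitian_matrix (cadjoint g ** g)" by (simp add: hermitian_matrix_def cadjoint_mult)
  then obtain U x where U: "unitary_matrix U" and x: "cadjoint g ** g = U ** real_diag x ** cadjoint U"
    by (rule hermitian_spectral)
  have UU: "cadjoint U ** U = mat 1" "U ** cadjoint U = mat 1"
    using U by (auto simp: unitary_matrix_def)
  define h where "h = g ** U"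
  have hh: "cadjoint h ** h = real_diag x"
  proof -
    have "cadjoint h ** h = cadjoint U ** (cadjoint g ** g) ** U"
      by (simp add: h_def cadjoint_mult matrix_mul_assoc)
    also have "\<dots> = (cadjoint U ** U) ** real_diag x ** (cadjoint U ** U)"
      by (simp add: x matrix_mul_assoc)
    finally show ?thesis by (simp add: UU)
  qed
  have h: "invertible h" unfolding h_def by (intro invertible_mult g unitary_invertible U)
  have "x $ i > 0" for i
  proof -
    have xi: "complex_of_real (x $ i) = (\<Sum>k\<in>UNIV. of_real ((cmod (h $ k $ i))\<^sup>2))"
      using arg_cong[OF hh, of "\<lambda>A. A $ i $ i"]
      by (simp add: matrix_matrix_mult_def mult.commute flip: complex_norm_square)
    then have xi: "x $ i = (\<Sum>k\<in>UNIV. (cmod (h $ k $ i))\<^sup>2)"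
      by (simp only: of_real_sum[symmetric] of_real_eq_iff)
    have "\<exists>k. h $ k $ i \<noteq> 0"
    proof (rule ccontr)
      assume 0: "\<nexists>k. h $ k $ i \<noteq> 0"
      obtain C where "C ** h = mat 1" using h invertible_def by blast
      then have "(C ** h) $ i $ i = 1" by (simp add: mat_def)
      with 0 show False by (simp add: matrix_matrix_mult_def)
    qed
    then obtain k where "h $ k $ i \<noteq> 0" by blast
    then show ?thesis unfolding xi by (intro sum_pos2[where i = k]) auto
  qed
  note pos = this
  define y where "y = (\<chi> i. ln (x $ i) / 2)"
  define k where "k = h ** exp_diag (-y)"
  have "exp (- y $ i) * (x $ i * exp (- y $ i)) = 1" for i
  proof -
    have "exp (- y $ i) * (x $ i * exp (- y $ i)) = x $ i * exp (- y $ i + - y $ i)"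
      by (simp only: exp_add mult_ac)
    also have "- y $ i + - y $ i = - ln (x $ i)" by (simp add: y_def)
    finally show ?thesis using pos[of i] by (simp add: exp_minus)
  qed
  then have 1: "exp_diag (-y) ** (real_diag x ** exp_diag (-y)) = mat 1"
    by (simp add: exp_diag_def real_diag_mult real_diag_one)
  have "cadjoint k ** k = exp_diag (-y) ** (cadjoint h ** h ** exp_diag (-y))"
    by (simp add: k_def cadjoint_mult matrix_mul_assoc)
  also have "\<dots> = mat 1" by (simp add: hh 1)
  finally have "unitary_matrix k" by (simp add: unitary_matrix_def matrix_left_right_inverse)
  moreover have "k ** exp_diag y ** cadjoint U = h ** (exp_diag (-y) ** exp_diag y) ** cadjoint U"
    by (simp add: k_def matrix_mul_assoc)
  then have "k ** exp_diag y ** cadjoint U = g ** (U ** cadjoint U)"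
    by (simp add: exp_diag_inverse h_def matrix_mul_assoc)
  then have "g = k ** exp_diag y ** cadjoint U" by (simp add: UU)
  ultimately show ?thesis using that U unitary_cadjoint by blast
qed

lemma sums_vecI:
  fixes f :: "nat \<Rightarrow> 'a::real_normed_vector^'n"
  assumes "\<And>i. (\<lambda>k. f k $ i) sums (s $ i)"
  shows "f sums s"
  using assms unfolding sums_def by (intro vec_tendstoI) simp

text \<open>Diagonalization turns the exponential series, entry by entry, into scalar series.\<close>
lemma matrix_exp_diagonalized:
  fixes U :: "complex^'n::finite^'n"
  assumes U: "unitary_matrix U"
  shows "matrix_exp (U ** real_diag x ** cadjoint U) = U ** exp_diag x ** cadjoint U"
proof -
  let ?A = "U ** real_diag x ** cadjoint U"
  have UU: "cadjoint U ** U = mat 1" "U ** cadjoint U = mat 1"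
    using U by (auto simp: unitary_matrix_def)
  have power: "((**) ?A ^^ k) (mat 1) = U ** real_diag (\<chi> i. x $ i ^ k) ** cadjoint U" for k
  proof (induction k)
    case 0
    show ?case by (simp add: real_diag_one UU)
  next
    case (Suc k)
    have "((**) ?A ^^ Suc k) (mat 1)
        = U ** real_diag x ** (cadjoint U ** U) ** real_diag (\<chi> i. x $ i ^ k) ** cadjoint U"
      using Suc by (simp add: matrix_mul_assoc)
    also have "\<dots> = U ** (real_diag x ** real_diag (\<chi> i. x $ i ^ k)) ** cadjoint U"
      by (simp add: UU matrix_mul_assoc)
    finally show ?case by (simp add: real_diag_mult)
  qed
  have entry: "(U ** real_diag y ** cadjoint U) $ i $ j
      = (\<Sum>l\<in>UNIV. U $ i $ l * of_real (y $ l) * cnj (U $ j $ l))" for y i j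
    by (simp add: matrix_matrix_mult_def if_distrib[of "\<lambda>y. _ * y"] cong: if_cong)
  have "(\<lambda>k. inverse (fact k) *\<^sub>R (((**) ?A ^^ k) (mat 1))) sums (U ** exp_diag x ** cadjoint U)"
  proof (intro sums_vecI)
    fix i j
    have "(\<lambda>k. \<Sum>l\<in>UNIV. U $ i $ l * of_real (x $ l ^ k /\<^sub>R fact k) * cnj (U $ j $ l)) sums
        (\<Sum>l\<in>UNIV. U $ i $ l * of_real (exp (x $ l)) * cnj (U $ j $ l))"
      by (intro sums_sum sums_mult sums_mult2 sums_of_real exp_converges)
    then show "(\<lambda>k. (inverse (fact k) *\<^sub>R (((**) ?A ^^ k) (mat 1))) $ i $ j) sums
        (U ** exp_diag x ** cadjoint U) $ i $ j"
      unfolding power exp_diag_def entry vector_scaleR_component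
      by (simp add: sum_distrib_left scaleR_conv_of_real[where 'a=complex] mult_ac)
  qed
  then show ?thesis unfolding matrix_exp_def by (rule sums_unique[symmetric])
qed

lemma frobenius_norm_eq: "frobenius_norm A = norm A"
  unfolding frobenius_norm_def norm_vec_def L2_set_def
  by (simp add: sum_nonneg)

lemma Re_trace_adjoint: "Re (trace (cadjoint A ** B)) = A \<bullet> B"
  unfolding trace_def matrix_matrix_mult_def inner_vec_def inner_complex_def
  by simp (rule sum.swap)

lemma norm_diagonalized:
  fixes U :: "complex^'n::finite^'n"
  assumes U: "unitary_matrix U"
  shows "norm (U ** real_diag x ** cadjoint U) = norm x"
proof -
  let ?A = "U ** real_diag x ** cadjoint U"
  have UU: "cadjoint U ** U = mat 1" using U by (auto simp: unitary_matrix_def)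
  have "cadjoint ?A ** ?A = U ** (real_diag x ** (cadjoint U ** U) ** real_diag x) ** cadjoint U"
    by (simp add: cadjoint_mult matrix_mul_assoc)
  then have "trace (cadjoint ?A ** ?A) = trace (U ** (real_diag (\<chi> i. x $ i * x $ i) ** cadjoint U))"
    by (simp add: UU real_diag_mult matrix_mul_assoc)
  also have "\<dots> = trace (real_diag (\<chi> i. x $ i * x $ i) ** (cadjoint U ** U))"
    by (subst trace_mul_sym) (simp add: matrix_mul_assoc)
  also have "\<dots> = of_real (x \<bullet> x)"
    by (simp add: UU trace_def inner_vec_def)
  finally have "Re (trace (cadjoint ?A ** ?A)) = x \<bullet> x" by simp
  then have "?A \<bullet> ?A = x \<bullet> x" unfolding Re_trace_adjoint .
  then show ?thesis by (simp add: norm_eq_sqrt_inner)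
qed

section \<open>Rational functions and characters of the torus\<close>

lemma rational_fun_sum:
  assumes "\<And>i. i \<in> S \<Longrightarrow> rational_fun (p i)"
  shows "rational_fun (\<lambda>g. \<Sum>i\<in>S. p i g)"
  using assms by (induction S rule: infinite_finite_induct) (auto intro: rational_fun.intros)

lemma differentiable_entry: "(\<lambda>g::complex^'n::finite^'n. g $ i $ j) differentiable (at g)"
proof -
  have "bounded_linear (\<lambda>g::complex^'n^'n. g $ i $ j)"
    using bounded_linear_compose[OF bounded_linear_vec_nth bounded_linear_vec_nth] .
  then show ?thesis by (rule bounded_linear_imp_differentiable)
qed

lemma differentiable_prod:
  fixes f :: "'i \<Rightarrow> 'a::real_normed_vector \<Rightarrow> complex"
  assumes "\<And>i. i \<in> S \<Longrightarrow> f i differentiable (at x)"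
  shows "(\<lambda>x. \<Prod>i\<in>S. f i x) differentiable (at x)"
  using assms by (induction S rule: infinite_finite_induct) auto

lemma differentiable_det: "(det :: complex^'n::finite^'n \<Rightarrow> complex) differentiable (at g)"
  unfolding det_def
  by (intro differentiable_sum differentiable_mult differentiable_const differentiable_prod ballI
      differentiable_entry finite_permutations finite)

text \<open>The derivative at the identity is the source of the linearity of the moment map, and the
  resulting continuity is what makes limits of group elements act as expected.\<close>
lemma rational_fun_differentiable:
  fixes g :: "complex^'n::finite^'n"
  assumes "rational_fun p" "invertible g"
  shows "p differentiable (at g)"
  using assms
proof (induction rule: rational_fun.induct)
  case inv_det
  then have "det g \<noteq> 0" by (simp add: invertible_det_nz)
  then show ?case by (intro differentiable_inverse differentiable_det)
qed (auto intro: differentiable_entry)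

definition torus_char :: "int^'n \<Rightarrow> complex^'n \<Rightarrow> complex" where
  "torus_char \<omega> x = (\<Prod>i\<in>UNIV. (x $ i) powi (\<omega> $ i))"

abbreviation in_torus :: "complex^'n \<Rightarrow> bool" where
  "in_torus x \<equiv> \<forall>i. x $ i \<noteq> 0"

lemma torus_char_add: "in_torus x \<Longrightarrow> torus_char (\<omega> + \<eta>) x = torus_char \<omega> x * torus_char \<eta> x"
  by (simp add: torus_char_def power_int_add prod.distrib)

lemma torus_char_mult: "torus_char \<omega> (\<chi> i. x $ i * y $ i) = torus_char \<omega> x * torus_char \<omega> y"
  by (simp add: torus_char_def power_int_mult_distrib prod.distrib)

lemma torus_char_one [simp]: "torus_char \<omega> (\<chi> i. 1) = 1"
  by (simp add: torus_char_def)

lemma torus_char_single: "torus_char \<omega> (\<chi> j. if j = i then z else 1) = z powi (\<omega> $ i)"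
proof -
  have "torus_char \<omega> (\<chi> j. if j = i then z else 1) = (\<Prod>j\<in>UNIV. if j = i then z powi (\<omega> $ i) else 1)"
    unfolding torus_char_def by (intro prod.cong) auto
  then show ?thesis by simp
qed

lemma torus_char_exp:
  "torus_char \<omega> (\<chi> i. complex_of_real (exp (x $ i))) = of_real (exp (real_vec \<omega> \<bullet> x))"
proof -
  have "exp t powi k = exp (of_int k * t)" for t :: real and k
    by (simp add: exp_power_int mult.commute)
  then show ?thesis
    by (simp add: torus_char_def real_vec_def inner_vec_def exp_sum
        flip: of_real_power_int of_real_prod)
qed

text \<open>Dedekind's argument: translating a relation by a point \<open>y\<close> at which the characters \<open>a\<close> and
  \<open>b\<close> differ, and subtracting the \<open>a(y)\<close>-fold of the original, eliminates \<open>a\<close> but keeps \<open>b\<close>.\<close>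
lemma torus_chars_independent:
  assumes "finite F" and "\<And>x. in_torus x \<Longrightarrow> (\<Sum>\<omega>\<in>F. c \<omega> * torus_char \<omega> x) = 0" and "\<omega> \<in> F"
  shows "c \<omega> = (0::complex)"
  using assms
proof (induction F arbitrary: c \<omega> rule: finite_induct)
  case (insert a F)
  have F: "c b = 0" if b: "b \<in> F" for b
  proof -
    have "a \<noteq> b" using b insert.hyps by blast
    then obtain i where i: "a $ i \<noteq> b $ i" by (auto simp: vec_eq_iff)
    define y :: "complex^'a" where "y = (\<chi> j. if j = i then 2 else 1)"
    have y: "in_torus y" by (simp add: y_def)
    have "c b * (torus_char b y - torus_char a y) = 0"
    proof (rule insert.IH[where c = "\<lambda>b. c b * (torus_char b y - torus_char a y)", OF _ b])
      fix x :: "complex^'a" assume x: "in_torus x"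
      have 1: "(\<Sum>\<omega>\<in>insert a F. c \<omega> * torus_char \<omega> x) = 0" using insert.prems(1) x .
      have 2: "(\<Sum>\<omega>\<in>insert a F. c \<omega> * torus_char \<omega> (\<chi> i. x $ i * y $ i)) = 0"
        using x y by (intro insert.prems(1)) auto
      have "(\<Sum>b\<in>F. c b * (torus_char b y - torus_char a y) * torus_char b x)
          = (\<Sum>\<omega>\<in>insert a F. c \<omega> * torus_char \<omega> (\<chi> i. x $ i * y $ i))
            - torus_char a y * (\<Sum>\<omega>\<in>insert a F. c \<omega> * torus_char \<omega> x)"
        using insert.hyps
        by (simp add: torus_char_mult algebra_simps sum_distrib_left sum_subtractf)
      then show "(\<Sum>b\<in>F. c b * (torus_char b y - torus_char a y) * torus_char b x) = 0"
        using 1 2 by simp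
    qed
    moreover have "torus_char b y \<noteq> torus_char a y"
    proof
      assume "torus_char b y = torus_char a y"
      then have "(2::complex) powi (b $ i) = 2 powi (a $ i)"
        unfolding y_def torus_char_single .
      then have "complex_of_real (2 powi (b $ i)) = complex_of_real (2 powi (a $ i))"
        by (simp only: of_real_power_int of_real_numeral)
      then have "(2::real) powi (b $ i) = 2 powi (a $ i)"
        unfolding of_real_eq_iff .
      then show False using i power_int_strict_increasing[of "b $ i" "a $ i" "2::real"]
          power_int_strict_increasing[of "a $ i" "b $ i" "2::real"]
        by (cases "a $ i < b $ i") auto
    qed
    ultimately show ?thesis by simp
  qed
  have "c a = 0" using insert.prems(1)[of "\<chi> i. 1"] insert.hyps F by simp
  with F insert.prems show ?case by blast
qed simp

text \<open>The finitely many exponents that occur in the entries of a representation on the torus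
  will be a bound for its set of weights.\<close>
definition laurent :: "(complex^'n \<Rightarrow> complex) \<Rightarrow> bool" where
  "laurent f \<longleftrightarrow> (\<exists>F c. finite F \<and> (\<forall>x. in_torus x \<longrightarrow> f x = (\<Sum>\<omega>\<in>F. c \<omega> * torus_char \<omega> x)))"

lemma laurentI:
  assumes "finite F" "\<And>x. in_torus x \<Longrightarrow> f x = (\<Sum>\<omega>\<in>F. c \<omega> * torus_char \<omega> x)"
  shows "laurent f"
  using assms unfolding laurent_def by blast

lemma laurent_char: "(\<And>x. in_torus x \<Longrightarrow> f x = a * torus_char \<omega> x) \<Longrightarrow> laurent f"
  by (rule laurentI[of "{\<omega>}" _ "\<lambda>_. a"]) auto

lemma laurent_add:
  assumes "laurent f" "laurent g" shows "laurent (\<lambda>x. f x + g x)"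
proof -
  obtain F c where F: "finite F" "\<And>x. in_torus x \<Longrightarrow> f x = (\<Sum>\<omega>\<in>F. c \<omega> * torus_char \<omega> x)"
    using assms(1) unfolding laurent_def by metis
  obtain G d where G: "finite G" "\<And>x. in_torus x \<Longrightarrow> g x = (\<Sum>\<omega>\<in>G. d \<omega> * torus_char \<omega> x)"
    using assms(2) unfolding laurent_def by metis
  let ?c = "\<lambda>\<omega>. if \<omega> \<in> F then c \<omega> else 0" and ?d = "\<lambda>\<omega>. if \<omega> \<in> G then d \<omega> else 0"
  show ?thesis
  proof (rule laurentI[of "F \<union> G" _ "\<lambda>\<omega>. ?c \<omega> + ?d \<omega>"])
    fix x :: "complex^'a" assume x: "in_torus x"
    have "f x = (\<Sum>\<omega>\<in>F \<union> G. ?c \<omega> * torus_char \<omega> x)"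
      using F(1) G(1) unfolding F(2)[OF x] by (intro sum.mono_neutral_cong_left) auto
    moreover have "g x = (\<Sum>\<omega>\<in>F \<union> G. ?d \<omega> * torus_char \<omega> x)"
      using F(1) G(1) unfolding G(2)[OF x] by (intro sum.mono_neutral_cong_left) auto
    ultimately show "f x + g x = (\<Sum>\<omega>\<in>F \<union> G. (?c \<omega> + ?d \<omega>) * torus_char \<omega> x)"
      by (simp add: distrib_right sum.distrib)
  qed (use F G in auto)
qed

lemma laurent_mult:
  assumes "laurent f" "laurent g" shows "laurent (\<lambda>x. f x * g x)"
proof -
  obtain F c where F: "finite F" "\<And>x. in_torus x \<Longrightarrow> f x = (\<Sum>\<omega>\<in>F. c \<omega> * torus_char \<omega> x)"
    using assms(1) unfolding laurent_def by metis
  obtain G d where G: "finite G" "\<And>x. in_torus x \<Longrightarrow> g x = (\<Sum>\<omega>\<in>G. d \<omega> * torus_char \<omega> x)"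
    using assms(2) unfolding laurent_def by metis
  let ?h = "\<lambda>q. fst q + snd q"
  let ?e = "\<lambda>\<eta>. \<Sum>q | q \<in> F \<times> G \<and> ?h q = \<eta>. c (fst q) * d (snd q)"
  show ?thesis
  proof (rule laurentI[of "?h ` (F \<times> G)" _ ?e])
    fix x :: "complex^'a" assume x: "in_torus x"
    have "f x * g x = (\<Sum>q\<in>F \<times> G. c (fst q) * d (snd q) * torus_char (?h q) x)"
      unfolding F(2)[OF x] G(2)[OF x] sum_product sum.cartesian_product
      using x by (intro sum.cong) (auto simp: torus_char_add)
    also have "\<dots> = (\<Sum>\<eta>\<in>?h ` (F \<times> G).
        \<Sum>q | q \<in> F \<times> G \<and> ?h q = \<eta>. c (fst q) * d (snd q) * torus_char (?h q) x)"
      using F(1) G(1) by (intro sum.group[symmetric]) auto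
    also have "\<dots> = (\<Sum>\<eta>\<in>?h ` (F \<times> G). ?e \<eta> * torus_char \<eta> x)"
      unfolding sum_distrib_right by (intro sum.cong refl) auto
    finally show "f x * g x = (\<Sum>\<eta>\<in>?h ` (F \<times> G). ?e \<eta> * torus_char \<eta> x)" .
  qed (use F G in auto)
qed

lemma det_diag_matrix: "det (diag_matrix x :: complex^'n::finite^'n) = (\<Prod>i\<in>UNIV. x $ i)"
  by (subst det_diagonal) auto

text \<open>On diagonal matrices an entry is zero or a coordinate, and the inverse determinant is the
  character with all exponents \<open>-1\<close>.\<close>
lemma rational_fun_laurent:
  assumes "rational_fun p"
  shows "laurent (\<lambda>x::complex^'n::finite. p (diag_matrix x))"
  using assms
proof (induction rule: rational_fun.induct)
  case (const c)
  show ?case by (rule laurent_char[of _ c 0]) (simp add: torus_char_def)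
next
  case (entry i j)
  have 1: "torus_char (\<chi> k. if k = i then 1 else 0) x = x $ i" for x :: "complex^'n"
  proof -
    have "torus_char (\<chi> k. if k = i then 1 else 0) x = (\<Prod>k\<in>UNIV. if k = i then x $ i else 1)"
      unfolding torus_char_def by (intro prod.cong) auto
    then show ?thesis by simp
  qed
  show ?case
    by (rule laurent_char[of _ "if i = j then 1 else 0" "\<chi> k. if k = i then 1 else 0"])
      (simp add: 1)
next
  case inv_det
  show ?case
    by (rule laurent_char[of _ 1 "\<chi> k. -1"])
      (simp add: torus_char_def det_diag_matrix prod_inversef[symmetric] power_int_minus)
qed (auto intro: laurent_add laurent_mult)

lemma diag_matrix_invertible: "in_torus x \<Longrightarrow> invertible (diag_matrix x :: complex^'n::finite^'n)"
  by (simp add: invertible_det_nz det_diag_matrix)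

section \<open>Weight spaces and adjoints\<close>

context rational_unitary_rep
begin

lemma ip_add_left: "ip (x + y) z = ip x z + ip y z"
  by (subst ip_commute) (simp add: ip_add_right flip: ip_commute)

lemma ip_scale_left: "ip (smul a x) y = cnj a * ip x y"
  by (subst ip_commute) (simp add: ip_scale_right flip: ip_commute)

lemma ip_zero_right [simp]: "ip x 0 = 0"
  using ip_scale_right[of x 0 0] by simp

lemma ip_zero_left [simp]: "ip 0 x = 0"
  by (subst ip_commute) simp

lemma ip_diff_right: "ip x (y - z) = ip x y - ip x z"
  using ip_add_right[of x "y - z" z] by simp

lemma ip_sum_right: "ip x (\<Sum>a\<in>A. f a) = (\<Sum>a\<in>A. ip x (f a))"
  by (induction A rule: infinite_finite_induct) (auto simp: ip_add_right)

lemma ip_sum_left: "ip (\<Sum>a\<in>A. f a) x = (\<Sum>a\<in>A. ip (f a) x)"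
  by (induction A rule: infinite_finite_induct) (auto simp: ip_add_left)

lemma ip_self_zero [simp]: "ip x x = 0 \<longleftrightarrow> x = 0"
  using ip_pos[of x] by force

lemma ip_self_nonneg: "Re (ip x x) \<ge> 0"
  using ip_pos[of x] by (cases "x = 0") auto

lemma Im_ip_self [simp]: "Im (ip x x) = 0"
  using arg_cong[OF ip_commute[of x x], of Im] by simp

lemma eq_by_ip: "(\<And>z. ip z x = ip z y) \<Longrightarrow> x = y"
  using ip_self_zero[of "x - y"] by (simp add: ip_diff_right)

lemma norm_square: "(ip_norm ip x)\<^sup>2 = Re (ip x x)"
  unfolding ip_norm_def by (simp add: ip_self_nonneg)

lemma norm_pos: "x \<noteq> 0 \<Longrightarrow> ip_norm ip x > 0"
  unfolding ip_norm_def by (simp add: ip_pos)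

lemma norm_nonneg: "ip_norm ip x \<ge> 0"
  unfolding ip_norm_def by (simp add: ip_self_nonneg)

lemma rep_add: "invertible g \<Longrightarrow> \<pi> g (x + y) = \<pi> g x + \<pi> g y"
  using rep_linear[of g] unfolding Vector_Spaces.linear_iff by blast

lemma rep_scale: "invertible g \<Longrightarrow> \<pi> g (smul a x) = smul a (\<pi> g x)"
  using rep_linear[of g] unfolding Vector_Spaces.linear_iff by blast

lemma rep_zero [simp]: "invertible g \<Longrightarrow> \<pi> g 0 = 0"
  using rep_scale[of g 0 0] by simp

lemma rep_sum: "invertible g \<Longrightarrow> \<pi> g (\<Sum>a\<in>A. f a) = (\<Sum>a\<in>A. \<pi> g (f a))"
  by (induction A rule: infinite_finite_induct) (auto simp: rep_add)

lemma rep_compose: "invertible g \<Longrightarrow> invertible h \<Longrightarrow> \<pi> g (\<pi> h x) = \<pi> (g ** h) x"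
  by (simp add: rep_mult)

lemma rep_one_apply [simp]: "\<pi> (mat 1) x = x"
  by (simp add: rep_one)

lemma rep_nonzero:
  assumes "invertible g" "x \<noteq> 0" shows "\<pi> g x \<noteq> 0"
proof
  assume 0: "\<pi> g x = 0"
  obtain h where h: "h ** g = mat 1" "g ** h = mat 1" using assms invertible_def by blast
  then have "invertible h" using invertible_def by blast
  then have "x = \<pi> h (\<pi> g x)" using h assms by (simp add: rep_compose)
  with 0 \<open>invertible h\<close> assms show False by simp
qed

lemma rep_unitary_norm: "unitary_matrix u \<Longrightarrow> ip_norm ip (\<pi> u x) = ip_norm ip x"
  by (simp add: ip_norm_def rep_unitary)

lemma rep_unitary_adjoint:
  assumes u: "unitary_matrix u" shows "ip (\<pi> u x) y = ip x (\<pi> (cadjoint u) y)"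
proof -
  have "ip (\<pi> u x) y = ip (\<pi> u x) (\<pi> u (\<pi> (cadjoint u) y))"
    using u by (simp add: rep_compose unitary_invertible) (simp add: unitary_matrix_def)
  then show ?thesis using u by (simp add: rep_unitary)
qed

lemma representation_expand:
  "(\<Sum>b\<in>B. smul (representation B v b) b) = v"
  by (rule sum_representation_eq) (auto simp: independent_Basis span_Basis finite_Basis)

text \<open>Rationality of the matrix entries in the basis \<open>B\<close> extends by linearity to a statement that
  mentions no basis. It replaces a topology on \<open>'v\<close>: limits and derivatives are taken of
  coefficients.\<close>
lemma matrix_coefficient_rational:
  "\<exists>p. rational_fun p \<and> (\<forall>g. invertible g \<longrightarrow> ip y (\<pi> g x) = p g)"
proof -
  define q where "q b c = (SOME p. rational_fun p \<and>
    (\<forall>g. invertible g \<longrightarrow> representation B (\<pi> g b) c = p g))" for b c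
  have q: "rational_fun (q b c) \<and> (\<forall>g. invertible g \<longrightarrow> representation B (\<pi> g b) c = q b c g)"
    if "b \<in> B" "c \<in> B" for b c
    unfolding q_def using someI_ex[OF rep_rational[OF that]] .
  let ?p = "\<lambda>g. \<Sum>b\<in>B. \<Sum>c\<in>B. representation B x b * (q b c g * ip y c)"
  have "rational_fun ?p"
    using q by (intro rational_fun_sum rational_fun.mult rational_fun.const) auto
  moreover have "ip y (\<pi> g x) = ?p g" if g: "invertible g" for g
  proof -
    have "\<pi> g b = (\<Sum>c\<in>B. smul (q b c g) c)" if "b \<in> B" for b
      using representation_expand[of "\<pi> g b"] q that g by simp
    moreover have "\<pi> g x = (\<Sum>b\<in>B. smul (representation B x b) (\<pi> g b))"
      using g by (simp flip: rep_scale rep_sum add: representation_expand)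
    ultimately show ?thesis by (simp add: ip_sum_right ip_scale_right sum_distrib_left)
  qed
  ultimately show ?thesis by blast
qed

definition weight_space :: "(int^'n) \<Rightarrow> 'v set" where
  "weight_space \<omega> = {w. \<forall>x. in_torus x \<longrightarrow> \<pi> (diag_matrix x) w = smul (torus_char \<omega> x) w}"

lemma weights_iff: "\<omega> \<in> weights smul \<pi> \<longleftrightarrow> (\<exists>w\<in>weight_space \<omega>. w \<noteq> 0)"
  by (auto simp: weights_def weight_space_def torus_char_def)

lemma weight_spaceD: "w \<in> weight_space \<omega> \<Longrightarrow> in_torus x \<Longrightarrow> \<pi> (diag_matrix x) w = smul (torus_char \<omega> x) w"
  by (simp add: weight_space_def)

lemma zero_weight_space [simp]: "0 \<in> weight_space \<omega>"
  by (simp add: weight_space_def diag_matrix_invertible)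

lemma weight_space_exp_diag:
  assumes "w \<in> weight_space \<omega>"
  shows "\<pi> (exp_diag x) w = smul (of_real (exp (real_vec \<omega> \<bullet> x))) w"
  using weight_spaceD[OF assms, of "\<chi> i. complex_of_real (exp (x $ i))"]
  by (simp add: exp_diag_def real_diag_def torus_char_exp)

text \<open>If the weights differ by \<open>k\<close> in one coordinate, put \<open>z = exp(i pi / k)\<close> there and 1 elsewhere.
  This diagonal matrix is unitary and multiplies the inner product by \<open>z\<close> to the power \<open>k\<close>, which
  is \<open>-1\<close>.\<close>
lemma weight_spaces_orthogonal:
  assumes v: "v \<in> weight_space \<omega>" and w: "w \<in> weight_space \<eta>" and ne: "\<omega> \<noteq> \<eta>"
  shows "ip v w = 0"
proof -
  obtain i where i: "\<omega> $ i \<noteq> \<eta> $ i" using ne by (auto simp: vec_eq_iff)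
  define k where "k = \<eta> $ i - \<omega> $ i"
  have k: "k \<noteq> 0" using i by (simp add: k_def)
  define z where "z = cis (pi / of_int k)"
  define y :: "complex^'n" where "y = (\<chi> j. if j = i then z else 1)"
  have z: "cnj z * z = 1" by (simp add: z_def cis_cnj cis_mult)
  then have z0: "z \<noteq> 0" by auto
  have y: "in_torus y" using z0 by (simp add: y_def)
  have "unitary_matrix (diag_matrix y)"
  proof -
    have "cadjoint (diag_matrix y) = diag_matrix (\<chi> i. cnj (y $ i))"
      by (simp add: vec_eq_iff)
    moreover have "(\<chi> i. cnj (y $ i) * y $ i) = (\<chi> i. 1)" "(\<chi> i. y $ i * cnj (y $ i)) = (\<chi> i. 1)"
      using z by (auto simp: vec_eq_iff y_def mult.commute)
    ultimately show ?thesis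
      by (simp add: unitary_matrix_def diag_matrix_mult diag_matrix_one)
  qed
  then have "ip v w = ip (\<pi> (diag_matrix y) v) (\<pi> (diag_matrix y) w)"
    by (simp add: rep_unitary)
  also have "\<dots> = cnj (z powi (\<omega> $ i)) * z powi (\<eta> $ i) * ip v w"
    using weight_spaceD[OF v y] weight_spaceD[OF w y]
    by (simp add: ip_scale_left ip_scale_right y_def torus_char_single)
  also have "cnj (z powi (\<omega> $ i)) * z powi (\<eta> $ i) = -1"
  proof -
    have "cnj z = inverse z" using z z0 by (simp add: field_simps)
    then have "cnj (z powi (\<omega> $ i)) = z powi (- (\<omega> $ i))"
      by (simp add: power_int_minus power_int_inverse)
    then have "cnj (z powi (\<omega> $ i)) * z powi (\<eta> $ i) = z powi k"
      using z0 by (simp add: k_def power_int_add[symmetric])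
    also have "\<dots> = cis (of_int k * (pi / of_int k))" unfolding z_def by (rule cis_power_int)
    also have "\<dots> = -1" using k by simp
    finally show ?thesis .
  qed
  finally show ?thesis by simp
qed

text \<open>Rationality gives an expansion of \<open>\<pi>(diag(x)) v\<close> as a Laurent polynomial in \<open>x\<close> with
  coefficients \<open>P v \<omega>\<close> in \<open>'v\<close>. Compute \<open>\<pi>(diag(x y)) v\<close> by this expansion and as
  \<open>\<pi>(diag(y)) (\<pi>(diag(x)) v)\<close>: since characters in \<open>x\<close> are independent, each \<open>P v \<omega>\<close> has weight
  \<open>\<omega>\<close>. At \<open>x = 1\<close> these vectors sum to \<open>v\<close>.\<close>
lemma weight_decomposition_aux:
  "\<exists>F c. finite F \<and> (\<forall>v. v = (\<Sum>\<omega>\<in>F. c v \<omega>) \<and> (\<forall>\<omega>\<in>F. c v \<omega> \<in> weight_space \<omega>))"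
proof -
  have ex: "\<exists>F c. finite F \<and> (\<forall>x. in_torus x \<longrightarrow>
      representation B (\<pi> (diag_matrix x) b) c' = (\<Sum>\<omega>\<in>F. c \<omega> * torus_char \<omega> x))"
    if bc: "b \<in> B" "c' \<in> B" for b c'
  proof -
    obtain p where "rational_fun p" and p: "\<And>g. invertible g \<Longrightarrow> representation B (\<pi> g b) c' = p g"
      using rep_rational[OF bc] by blast
    then have "laurent (\<lambda>x. representation B (\<pi> (diag_matrix x) b) c') \<longleftrightarrow> laurent (\<lambda>x. p (diag_matrix x))"
      unfolding laurent_def by (simp add: diag_matrix_invertible)
    then show ?thesis using rational_fun_laurent[OF \<open>rational_fun p\<close>] unfolding laurent_def by blast
  qed
  then obtain F a where F: "\<And>b c. b \<in> B \<Longrightarrow> c \<in> B \<Longrightarrow> finite (F b c)"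
    and a: "\<And>b c x. b \<in> B \<Longrightarrow> c \<in> B \<Longrightarrow> in_torus x \<Longrightarrow>
      representation B (\<pi> (diag_matrix x) b) c = (\<Sum>\<omega>\<in>F b c. a b c \<omega> * torus_char \<omega> x)"
    by metis
  define G where "G = (\<Union>b\<in>B. \<Union>c\<in>B. F b c)"
  have G: "finite G" unfolding G_def by (intro finite_UN_I finite_Basis F)
  define d where "d b c \<omega> = (if \<omega> \<in> F b c then a b c \<omega> else 0)" for b c \<omega>
  have d: "representation B (\<pi> (diag_matrix x) b) c = (\<Sum>\<omega>\<in>G. d b c \<omega> * torus_char \<omega> x)"
    if "b \<in> B" "c \<in> B" "in_torus x" for b c x
    unfolding a[OF that] d_def using G that by (intro sum.mono_neutral_cong_left) (auto simp: G_def)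
  define P where "P v \<omega> = (\<Sum>b\<in>B. \<Sum>c\<in>B. smul (representation B v b * d b c \<omega>) c)" for v \<omega>
  have act: "\<pi> (diag_matrix x) v = (\<Sum>\<omega>\<in>G. smul (torus_char \<omega> x) (P v \<omega>))"
    if x: "in_torus x" for x v
  proof -
    have inv: "invertible (diag_matrix x)" using x by (rule diag_matrix_invertible)
    have "\<pi> (diag_matrix x) v = (\<Sum>b\<in>B. smul (representation B v b) (\<pi> (diag_matrix x) b))"
      using inv by (simp flip: rep_scale rep_sum add: representation_expand)
    also have "\<dots> = (\<Sum>b\<in>B. smul (representation B v b)
        (\<Sum>c\<in>B. smul (\<Sum>\<omega>\<in>G. d b c \<omega> * torus_char \<omega> x) c))"
    proof (intro sum.cong refl arg_cong[of _ _ "smul _"])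
      fix b assume b: "b \<in> B"
      show "\<pi> (diag_matrix x) b = (\<Sum>c\<in>B. smul (\<Sum>\<omega>\<in>G. d b c \<omega> * torus_char \<omega> x) c)"
        by (subst representation_expand[symmetric], intro sum.cong refl) (simp add: d b x)
    qed
    also have "\<dots> = (\<Sum>b\<in>B. \<Sum>c\<in>B. \<Sum>\<omega>\<in>G.
        smul (torus_char \<omega> x * (representation B v b * d b c \<omega>)) c)"
      by (simp add: scale_sum_right scale_sum_left mult_ac sum_distrib_left)
    also have "\<dots> = (\<Sum>b\<in>B. \<Sum>\<omega>\<in>G. \<Sum>c\<in>B.
        smul (torus_char \<omega> x * (representation B v b * d b c \<omega>)) c)"
      by (intro sum.cong refl sum.swap)
    also have "\<dots> = (\<Sum>\<omega>\<in>G. \<Sum>b\<in>B. \<Sum>c\<in>B.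
        smul (torus_char \<omega> x * (representation B v b * d b c \<omega>)) c)"
      by (rule sum.swap)
    also have "\<dots> = (\<Sum>\<omega>\<in>G. smul (torus_char \<omega> x) (P v \<omega>))"
      by (simp add: P_def scale_sum_right)
    finally show ?thesis .
  qed
  have "P v \<omega> \<in> weight_space \<omega>" if \<omega>: "\<omega> \<in> G" for v \<omega>
    unfolding weight_space_def
  proof (clarify, rule eq_by_ip)
    fix y :: "complex^'n" and z assume y: "in_torus y"
    let ?c = "\<lambda>\<omega>. ip z (\<pi> (diag_matrix y) (P v \<omega>)) - ip z (smul (torus_char \<omega> y) (P v \<omega>))"
    have "?c \<omega> = 0"
    proof (rule torus_chars_independent[OF G _ \<omega>])
      fix x :: "complex^'n" assume x: "in_torus x"
      have xy: "in_torus (\<chi> i. x $ i * y $ i)" using x y by simp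
      have inv: "invertible (diag_matrix x)" "invertible (diag_matrix y)"
        using x y by (simp_all add: diag_matrix_invertible)
      have "(\<Sum>\<omega>\<in>G. smul (torus_char \<omega> x) (\<pi> (diag_matrix y) (P v \<omega>)))
          = \<pi> (diag_matrix y) (\<pi> (diag_matrix x) v)"
        using inv by (simp add: act[OF x] rep_sum rep_scale)
      also have "\<dots> = \<pi> (diag_matrix (\<chi> i. x $ i * y $ i)) v"
        using inv by (simp add: rep_compose diag_matrix_mult mult.commute)
      also have "\<dots> = (\<Sum>\<omega>\<in>G. smul (torus_char \<omega> x) (smul (torus_char \<omega> y) (P v \<omega>)))"
        by (simp add: act[OF xy] torus_char_mult)
      finally have "(\<Sum>\<omega>\<in>G. ip z (smul (torus_char \<omega> x) (\<pi> (diag_matrix y) (P v \<omega>))))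
          = (\<Sum>\<omega>\<in>G. ip z (smul (torus_char \<omega> x) (smul (torus_char \<omega> y) (P v \<omega>))))"
        unfolding ip_sum_right[symmetric] by (rule arg_cong)
      then show "(\<Sum>\<omega>\<in>G. ?c \<omega> * torus_char \<omega> x) = 0"
        by (simp add: ip_scale_right left_diff_distrib right_diff_distrib sum_subtractf mult.commute mult.left_commute)
    qed
    then show "ip z (\<pi> (diag_matrix y) (P v \<omega>)) = ip z (smul (torus_char \<omega> y) (P v \<omega>))" by simp
  qed
  moreover have "v = (\<Sum>\<omega>\<in>G. P v \<omega>)" for v
    using act[of "\<chi> i. 1" v] by (simp add: diag_matrix_one)
  ultimately show ?thesis using G by blast
qed

text \<open>A vector whose weight lies outside \<open>F\<close> would be orthogonal to all its components, hence to
  itself.\<close>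
lemma finite_weights: "finite (weights smul \<pi>)"
proof -
  obtain F c where F: "finite F" and c: "\<And>v. v = (\<Sum>\<omega>\<in>F. c v \<omega>)"
    "\<And>v \<omega>. \<omega> \<in> F \<Longrightarrow> c v \<omega> \<in> weight_space \<omega>"
    using weight_decomposition_aux by blast
  have "weights smul \<pi> \<subseteq> F"
  proof
    fix \<eta> assume "\<eta> \<in> weights smul \<pi>"
    then obtain w where w: "w \<in> weight_space \<eta>" "w \<noteq> 0" by (auto simp: weights_iff)
    show "\<eta> \<in> F"
    proof (rule ccontr)
      assume "\<eta> \<notin> F"
      have "ip w (\<Sum>\<omega>\<in>F. c w \<omega>) = 0" unfolding ip_sum_right
        using \<open>\<eta> \<notin> F\<close> by (intro sum.neutral ballI weight_spaces_orthogonal[OF w(1) c(2)]) auto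
      then show False using c(1)[of w] w(2) by simp
    qed
  qed
  then show ?thesis using F finite_subset by blast
qed

lemma weight_decomposition_exists:
  "\<exists>c. (\<forall>\<omega>. c \<omega> \<in> weight_space \<omega>) \<and> v = (\<Sum>\<omega>\<in>weights smul \<pi>. c \<omega>)"
proof -
  obtain F c where F: "finite F" and c: "v = (\<Sum>\<omega>\<in>F. c \<omega>)"
    "\<And>\<omega>. \<omega> \<in> F \<Longrightarrow> c \<omega> \<in> weight_space \<omega>"
    using weight_decomposition_aux by blast
  let ?d = "\<lambda>\<omega>. if \<omega> \<in> F then c \<omega> else 0"
  have "(\<Sum>\<omega>\<in>F. c \<omega>) = (\<Sum>\<omega>\<in>F \<union> weights smul \<pi>. ?d \<omega>)"
    using F finite_weights by (intro sum.mono_neutral_cong_left) auto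
  also have "\<dots> = (\<Sum>\<omega>\<in>weights smul \<pi>. ?d \<omega>)"
    using F finite_weights c(2) by (intro sum.mono_neutral_cong_right) (auto simp: weights_iff)
  finally show ?thesis using c by (intro exI[of _ ?d]) auto
qed

text \<open>Since different weight spaces are orthogonal, there is exactly one choice at every weight: the
  orthogonal projection of \<open>v\<close> to the weight space.\<close>
definition weight_part :: "'v \<Rightarrow> int^'n \<Rightarrow> 'v" where
  "weight_part v = (SOME c. (\<forall>\<omega>. c \<omega> \<in> weight_space \<omega>) \<and> v = (\<Sum>\<omega>\<in>weights smul \<pi>. c \<omega>))"

lemma weight_part_in: "weight_part v \<omega> \<in> weight_space \<omega>"
  and weight_part_sum: "(\<Sum>\<omega>\<in>weights smul \<pi>. weight_part v \<omega>) = v"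
  using someI_ex[OF weight_decomposition_exists[of v]] unfolding weight_part_def by auto

lemma ip_weight_sums:
  assumes "\<And>\<omega>. c \<omega> \<in> weight_space \<omega>" "\<And>\<omega>. d \<omega> \<in> weight_space \<omega>"
  shows "ip (\<Sum>\<omega>\<in>weights smul \<pi>. c \<omega>) (\<Sum>\<omega>\<in>weights smul \<pi>. d \<omega>) =
     (\<Sum>\<omega>\<in>weights smul \<pi>. ip (c \<omega>) (d \<omega>))"
proof -
  have "(\<Sum>\<eta>\<in>weights smul \<pi>. ip (c \<omega>) (d \<eta>)) = (\<Sum>\<eta>\<in>weights smul \<pi>. if \<eta> = \<omega> then ip (c \<omega>) (d \<omega>) else 0)"
    for \<omega>
    by (intro sum.cong refl) (auto simp: weight_spaces_orthogonal[OF assms(1) assms(2)])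
  then show ?thesis by (subst ip_sum_left) (simp add: ip_sum_right finite_weights)
qed

lemma smul_weight_space: "w \<in> weight_space \<omega> \<Longrightarrow> smul a w \<in> weight_space \<omega>"
  by (simp add: weight_space_def rep_scale diag_matrix_invertible mult.commute)

lemma rep_exp_diag:
  "\<pi> (exp_diag x) v = (\<Sum>\<omega>\<in>weights smul \<pi>. smul (of_real (exp (real_vec \<omega> \<bullet> x))) (weight_part v \<omega>))"
  by (subst (1) weight_part_sum[symmetric])
    (simp add: rep_sum weight_space_exp_diag[OF weight_part_in])

lemma ip_exp_diag:
  "ip u (\<pi> (exp_diag x) v) =
    (\<Sum>\<omega>\<in>weights smul \<pi>. of_real (exp (real_vec \<omega> \<bullet> x)) * ip (weight_part u \<omega>) (weight_part v \<omega>))"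
proof -
  have "ip u (\<pi> (exp_diag x) v) = ip (\<Sum>\<omega>\<in>weights smul \<pi>. weight_part u \<omega>)
     (\<Sum>\<omega>\<in>weights smul \<pi>. smul (of_real (exp (real_vec \<omega> \<bullet> x))) (weight_part v \<omega>))"
    by (simp add: rep_exp_diag weight_part_sum)
  then show ?thesis
    by (simp add: ip_weight_sums weight_part_in smul_weight_space ip_scale_right)
qed

text \<open>A positive diagonal matrix acts on each weight space by a real number.\<close>
lemma exp_diag_self_adjoint: "ip (\<pi> (exp_diag x) u) v = ip u (\<pi> (exp_diag x) v)"
proof -
  have "ip (\<pi> (exp_diag x) u) v = cnj (ip v (\<pi> (exp_diag x) u))" by (rule ip_commute)
  also have "\<dots> = ip u (\<pi> (exp_diag x) v)"
    unfolding ip_exp_diag by (simp flip: ip_commute)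
  finally show ?thesis .
qed

text \<open>The unitarian trick. For unitary matrices this is the invariance of the inner product, for
  positive diagonal ones self-adjointness, and these generate \<open>GL(n)\<close>.\<close>
theorem rep_adjoint:
  assumes g: "invertible g"
  shows "ip (\<pi> g u) v = ip u (\<pi> (cadjoint g) v)"
proof -
  obtain k x l where k: "unitary_matrix k" and l: "unitary_matrix l" and g: "g = k ** exp_diag x ** l"
    using invertible_polar_diag[OF g] by blast
  note inv = unitary_invertible[OF k] unitary_invertible[OF l]
    unitary_invertible[OF unitary_cadjoint[THEN iffD2, OF k]]
    unitary_invertible[OF unitary_cadjoint[THEN iffD2, OF l]]
  have "ip (\<pi> g u) v = ip (\<pi> k (\<pi> (exp_diag x) (\<pi> l u))) v"
    using inv by (simp add: g rep_compose invertible_mult matrix_mul_assoc)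
  also have "\<dots> = ip u (\<pi> (cadjoint l) (\<pi> (exp_diag x) (\<pi> (cadjoint k) v)))"
    using k l by (simp add: rep_unitary_adjoint exp_diag_self_adjoint)
  also have "\<dots> = ip u (\<pi> (cadjoint g) v)"
    using inv by (simp add: g rep_compose invertible_mult matrix_mul_assoc cadjoint_mult)
  finally show ?thesis .
qed

lemma norm_exp_diag:
  "(ip_norm ip (\<pi> (exp_diag x) v))\<^sup>2 =
    (\<Sum>\<omega>\<in>weights smul \<pi>. exp (2 * (real_vec \<omega> \<bullet> x)) * (ip_norm ip (weight_part v \<omega>))\<^sup>2)"
proof -
  have "ip (\<pi> (exp_diag x) v) (\<pi> (exp_diag x) v) = ip v (\<pi> (exp_diag (x + x)) v)"
    by (simp only: exp_diag_self_adjoint rep_compose exp_diag_add invertible_exp_diag)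
  then show ?thesis
    by (simp only: norm_square ip_exp_diag inner_add_right mult_2 Re_sum) simp
qed

lemma norm_weight_parts:
  "(ip_norm ip v)\<^sup>2 = (\<Sum>\<omega>\<in>weights smul \<pi>. (ip_norm ip (weight_part v \<omega>))\<^sup>2)"
  using norm_exp_diag[of 0 v] by simp

end

section \<open>The moment map along one-parameter subgroups\<close>

text \<open>As a combination of fixed matrices with real coefficients, a conjugated diagonal matrix can be
  differentiated by the rules for scalar functions.\<close>
lemma conjugated_real_diag_sum:
  "U ** real_diag y ** V = (\<Sum>l\<in>UNIV. y $ l *\<^sub>R (U ** real_diag (axis l 1) ** V))"
proof -
  have entry: "(U ** real_diag z ** V) $ i $ j = (\<Sum>l\<in>UNIV. U $ i $ l * of_real (z $ l) * V $ l $ j)" for z i j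
    by (simp add: matrix_matrix_mult_def if_distrib[of "\<lambda>y. _ * y"] cong: if_cong)
  have 1: "(U ** real_diag (axis l 1) ** V) $ i $ j = U $ i $ l * V $ l $ j" for l i j
  proof -
    have "(U ** real_diag (axis l 1) ** V) $ i $ j = (\<Sum>m\<in>UNIV. if m = l then U $ i $ l * V $ l $ j else 0)"
      unfolding entry by (intro sum.cong) (auto simp: axis_def)
    then show ?thesis by simp
  qed
  have "(U ** real_diag y ** V) $ i $ j = (\<Sum>l\<in>UNIV. y $ l *\<^sub>R (U ** real_diag (axis l 1) ** V)) $ i $ j" for i j
    by (subst entry) (simp add: sum_component 1 scaleR_conv_of_real[where 'a=complex] mult_ac)
  then show ?thesis by (simp add: vec_eq_iff)
qed

lemma conjugated_exp_diag_derivative: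
  "((\<lambda>t. U ** exp_diag (t *\<^sub>R x) ** V) has_vector_derivative U ** real_diag x ** V) (at 0)"
proof -
  have "((\<lambda>t. exp (t * x $ l) *\<^sub>R (U ** real_diag (axis l 1) ** V)) has_vector_derivative
      x $ l *\<^sub>R (U ** real_diag (axis l 1) ** V)) (at 0)" for l
  proof -
    have "((\<lambda>t. exp (t * x $ l)) has_field_derivative x $ l) (at 0)"
      by (auto intro!: derivative_eq_intros)
    from has_vector_derivative_scaleR[OF this has_vector_derivative_const] show ?thesis by simp
  qed
  then have "((\<lambda>t. \<Sum>l\<in>UNIV. exp (t * x $ l) *\<^sub>R (U ** real_diag (axis l 1) ** V)) has_vector_derivative
      (\<Sum>l\<in>UNIV. x $ l *\<^sub>R (U ** real_diag (axis l 1) ** V))) (at 0)"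
    by (intro has_vector_derivative_sum) auto
  moreover have "U ** exp_diag (t *\<^sub>R x) ** V = (\<Sum>l\<in>UNIV. exp (t * x $ l) *\<^sub>R (U ** real_diag (axis l 1) ** V))" for t
    unfolding exp_diag_def by (subst conjugated_real_diag_sum) simp
  ultimately show ?thesis
    by (simp flip: conjugated_real_diag_sum)
qed

lemma scaleR_conjugated_real_diag:
  "t *\<^sub>R (U ** real_diag x ** V) = U ** real_diag (t *\<^sub>R x) ** V"
  by (subst (1 2) conjugated_real_diag_sum) (simp add: scaleR_sum_right)

lemma hermitian_conjugated_real_diag: "hermitian_matrix (U ** real_diag x ** cadjoint U)"
  by (simp add: hermitian_matrix_def cadjoint_mult matrix_mul_assoc)

lemma trace_cadjoint: "trace (cadjoint A) = cnj (trace A)"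
  by (simp add: trace_def)

lemma Im_trace_hermitian_mult:
  assumes "hermitian_matrix A" "hermitian_matrix B"
  shows "Im (trace (A ** B)) = 0"
proof -
  have "cnj (trace (A ** B)) = trace (B ** A)"
    using assms by (simp add: cadjoint_mult hermitian_matrix_def flip: trace_cadjoint)
  also have "\<dots> = trace (A ** B)" by (rule trace_mul_sym)
  finally show ?thesis by (simp add: complex_eq_iff)
qed

lemma trace_hermitian_mult:
  assumes "hermitian_matrix A" "hermitian_matrix B"
  shows "trace (A ** B) = complex_of_real (A \<bullet> B)"
  using Im_trace_hermitian_mult[OF assms] Re_trace_adjoint[of A B] assms
  by (simp add: complex_eq_iff hermitian_matrix_def)

lemma cadjoint_inner: "cadjoint A \<bullet> cadjoint B = A \<bullet> B"
  unfolding inner_vec_def inner_complex_def by simp (rule sum.swap)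

lemma hermitian_part_inner:
  assumes "hermitian_matrix H"
  shows "((1/2) *\<^sub>R (A + cadjoint A)) \<bullet> H = A \<bullet> H"
  using assms cadjoint_inner[of A H] by (simp add: inner_add hermitian_matrix_def)

lemma half_ln_derivative:
  fixes f :: "real \<Rightarrow> real"
  assumes "(f has_field_derivative d) (at a)" "f a = n" "n > 0"
  shows "((\<lambda>t. c + ln (f t) / 2) has_field_derivative d / n / 2) (at a)"
  using assms by (auto intro!: derivative_eq_intros)

lemma ln_of_square_eq:
  fixes N n S :: real
  assumes "N > 0" "n > 0" "N\<^sup>2 = n\<^sup>2 * S"
  shows "ln N = ln n + ln S / 2"
proof -
  have "0 < n\<^sup>2 * S" using assms by (simp flip: assms(3))
  then have "S > 0" using assms(2) by (simp add: zero_less_mult_iff)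
  then show ?thesis using arg_cong[OF assms(3), of ln] assms(1,2) by (simp add: ln_mult ln_realpow)
qed

context rational_unitary_rep
begin

lemma rep_exp_conjugated:
  assumes U: "unitary_matrix U"
  shows "ip_norm ip (\<pi> (U ** exp_diag x ** cadjoint U) v) = ip_norm ip (\<pi> (exp_diag x) (\<pi> (cadjoint U) v))"
proof -
  have "\<pi> (U ** exp_diag x ** cadjoint U) v = \<pi> U (\<pi> (exp_diag x) (\<pi> (cadjoint U) v))"
    using U by (simp add: rep_compose invertible_mult unitary_invertible matrix_mul_assoc)
  then show ?thesis using U by (simp add: rep_unitary_norm)
qed

text \<open>The weight decomposition yields the derivative for one \<open>H\<close> in a basis that diagonalizes \<open>H\<close>,
  and so does not show linearity in \<open>H\<close>. But by \<open>rep_adjoint\<close> the squared norm of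
  \<open>\<pi>(exp(t H)) v\<close> is \<open>ip v (\<pi>(exp(2 t H)) v)\<close>, a rational function on the group along a curve through
  the identity with velocity \<open>2 H\<close>, and the chain rule applies.\<close>
lemma log_norm_derivative_linear:
  assumes v: "v \<noteq> 0"
  obtains L where "bounded_linear L" and "\<And>H. hermitian_matrix H \<Longrightarrow>
    ((\<lambda>t. ln (ip_norm ip (\<pi> (matrix_exp (t *\<^sub>R H)) v))) has_field_derivative L H) (at 0)"
proof -
  obtain p where "rational_fun p" and p: "\<And>g. invertible g \<Longrightarrow> ip v (\<pi> g v) = p g"
    using matrix_coefficient_rational[of v v] by blast
  then obtain D where D: "(p has_derivative D) (at (mat 1))"
    using rational_fun_differentiable[of p "mat 1"] invertible_def unfolding differentiable_def
    by (metis matrix_mul_lid)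
  let ?n = "Re (ip v v)"
  have n: "?n > 0" by (rule ip_pos[OF v])
  have "bounded_linear (\<lambda>H. Re (D H) / ?n)"
    using D has_derivative_bounded_linear bounded_linear_compose[OF bounded_linear_Re]
    by (intro bounded_linear_divide[THEN bounded_linear_compose]) auto
  moreover have "((\<lambda>t. ln (ip_norm ip (\<pi> (matrix_exp (t *\<^sub>R H)) v))) has_field_derivative Re (D H) / ?n) (at 0)"
    if H: "hermitian_matrix H" for H
  proof -
    obtain U x where U: "unitary_matrix U" and x: "H = U ** real_diag x ** cadjoint U"
      using hermitian_spectral[OF H] .
    have inv: "invertible U" "invertible (cadjoint U)" using U by (simp_all add: unitary_invertible)
    have UU: "U ** cadjoint U = mat 1" "cadjoint U ** U = mat 1" using U by (auto simp: unitary_matrix_def)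
    let ?c = "\<lambda>t::real. U ** exp_diag (t *\<^sub>R ((2::real) *\<^sub>R x)) ** cadjoint U"
    let ?w = "\<pi> (cadjoint U) v"
    have norm: "ln (ip_norm ip (\<pi> (matrix_exp (t *\<^sub>R H)) v)) = ln (Re (p (?c t))) / 2" for t
    proof -
      have "(ip_norm ip (\<pi> (matrix_exp (t *\<^sub>R H)) v))\<^sup>2 = (ip_norm ip (\<pi> (exp_diag (t *\<^sub>R x)) ?w))\<^sup>2"
        by (simp add: x scaleR_conjugated_real_diag matrix_exp_diagonalized[OF U] rep_exp_conjugated[OF U])
      also have "\<dots> = Re (ip ?w (\<pi> (exp_diag (t *\<^sub>R x)) (\<pi> (exp_diag (t *\<^sub>R x)) ?w)))"
        by (simp add: norm_square exp_diag_self_adjoint)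
      also have "\<dots> = Re (ip v (\<pi> (?c t) v))"
        using U inv by (simp add: rep_unitary_adjoint rep_compose invertible_mult exp_diag_add
            matrix_mul_assoc scaleR_add_left[symmetric] mult.commute)
      also have "\<dots> = Re (p (?c t))" using inv by (simp add: p invertible_mult)
      finally have "(ip_norm ip (\<pi> (matrix_exp (t *\<^sub>R H)) v))\<^sup>2 = Re (p (?c t))" .
      then have "ip_norm ip (\<pi> (matrix_exp (t *\<^sub>R H)) v) = sqrt (Re (p (?c t)))"
        by (rule real_sqrt_unique[OF _ norm_nonneg, symmetric])
      moreover have "ip_norm ip (\<pi> (matrix_exp (t *\<^sub>R H)) v) > 0"
        using v inv by (intro norm_pos rep_nonzero)
          (simp_all add: x scaleR_conjugated_real_diag matrix_exp_diagonalized[OF U] invertible_mult)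
      ultimately show ?thesis by (simp add: ln_sqrt)
    qed
    have c0: "?c 0 = mat 1" by (simp add: UU)
    have c: "(?c has_vector_derivative 2 *\<^sub>R H) (at 0)"
      using conjugated_exp_diag_derivative[of U "2 *\<^sub>R x" "cadjoint U"]
      by (simp add: x scaleR_conjugated_real_diag)
    have D': "(p has_derivative D) (at (?c 0))" using D by (simp only: c0)
    have "((\<lambda>t. p (?c t)) has_vector_derivative D (2 *\<^sub>R H)) (at 0)"
      using vector_derivative_diff_chain_within[OF c has_derivative_at_withinI[OF D']]
      by (simp add: o_def)
    then have Re_deriv: "((\<lambda>t. Re (p (?c t))) has_field_derivative Re (D (2 *\<^sub>R H))) (at 0)"
      using bounded_linear.has_vector_derivative[OF bounded_linear_Re]
      by (simp add: has_real_derivative_iff_has_vector_derivative)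
    have "Re (p (?c 0)) = ?n" using p[of "mat 1"] unitary_invertible[of "mat 1 :: complex^'n^'n"]
      by (simp add: UU unitary_matrix_def)
    from half_ln_derivative[OF Re_deriv this n, of 0]
    have "((\<lambda>t. ln (Re (p (?c t))) / 2) has_field_derivative Re (D (2 *\<^sub>R H)) / ?n / 2) (at 0)"
      by simp
    moreover have "Re (D (2 *\<^sub>R H)) = 2 * Re (D H)"
      using bounded_linear.linear[OF has_derivative_bounded_linear[OF D]] by (simp add: linear_scale)
    ultimately show ?thesis by (simp add: norm)
  qed
  ultimately show ?thesis using that by blast
qed

text \<open>The Riesz vector of the linear derivative and its Hermitian part have the same pairing with
  Hermitian matrices; this gives existence. Uniqueness holds because the difference \<open>N\<close> of two
  solutions is Hermitian and its pairing with itself is the squared Frobenius norm of \<open>N\<close>.\<close>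
lemma moment_map_unique:
  assumes v: "v \<noteq> 0"
  shows "\<exists>!M. hermitian_matrix M \<and> (\<forall>H. hermitian_matrix H \<longrightarrow>
       ((\<lambda>t::real. complex_of_real (ln (ip_norm ip (\<pi> (matrix_exp (t *\<^sub>R H)) v))))
          has_vector_derivative trace (M ** H)) (at 0))"
proof -
  obtain L where L: "bounded_linear L" and deriv: "\<And>H. hermitian_matrix H \<Longrightarrow>
    ((\<lambda>t. ln (ip_norm ip (\<pi> (matrix_exp (t *\<^sub>R H)) v))) has_field_derivative L H) (at 0)"
    by (rule log_norm_derivative_linear[OF v]) blast
  define A where "A = (\<Sum>b\<in>Basis. L b *\<^sub>R b)"
  have A: "L H = A \<bullet> H" for H
  proof -
    have "L H = L (\<Sum>b\<in>Basis. (H \<bullet> b) *\<^sub>R b)" by (simp add: euclidean_representation)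
    also have "\<dots> = (\<Sum>b\<in>Basis. (H \<bullet> b) * L b)"
      using bounded_linear.linear[OF L] by (simp add: linear_sum linear_scale)
    finally show ?thesis by (simp add: A_def inner_sum_left inner_commute[of H] mult.commute)
  qed
  define M where "M = (1/2) *\<^sub>R (A + cadjoint A)"
  have M: "hermitian_matrix M"
    by (simp add: M_def hermitian_matrix_def vec_eq_iff add.commute)
  have deriv': "((\<lambda>t::real. complex_of_real (ln (ip_norm ip (\<pi> (matrix_exp (t *\<^sub>R H)) v))))
          has_vector_derivative trace (M ** H)) (at 0)" if H: "hermitian_matrix H" for H
  proof -
    have "trace (M ** H) = complex_of_real (L H)"
      using trace_hermitian_mult[OF M H] hermitian_part_inner[OF H, of A] by (simp only: A M_def)
    then show ?thesis using deriv[OF H] by (simp add: has_vector_derivative_of_real)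
  qed
  show ?thesis
  proof (rule ex1I[of _ M])
    fix M' assume M': "hermitian_matrix M' \<and> (\<forall>H. hermitian_matrix H \<longrightarrow>
       ((\<lambda>t::real. complex_of_real (ln (ip_norm ip (\<pi> (matrix_exp (t *\<^sub>R H)) v))))
          has_vector_derivative trace (M' ** H)) (at 0))"
    have N: "hermitian_matrix (M' - M)" using M M' by (simp add: hermitian_matrix_def vec_eq_iff)
    have "trace (M' ** (M' - M)) = trace (M ** (M' - M))"
      using vector_derivative_unique_at deriv'[OF N] M' N by blast
    then have "(M' - M) \<bullet> (M' - M) = 0"
      using M M' N by (simp add: trace_hermitian_mult inner_diff_left)
    then show "M' = M" by simp
  qed (use M deriv' in blast)
qed

lemma moment_map_characterization:
  assumes v: "v \<noteq> 0"
  shows "hermitian_matrix (moment_map ip \<pi> v) \<and> (\<forall>H. hermitian_matrix H \<longrightarrow>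
    ((\<lambda>t::real. complex_of_real (ln (ip_norm ip (\<pi> (matrix_exp (t *\<^sub>R H)) v))))
       has_vector_derivative trace (moment_map ip \<pi> v ** H)) (at 0))"
  using theI'[OF moment_map_unique[OF v]] unfolding moment_map_def .

lemma moment_map_hermitian: "v \<noteq> 0 \<Longrightarrow> hermitian_matrix (moment_map ip \<pi> v)"
  using moment_map_characterization[of v] by (rule conjunct1)

lemma moment_map_derivative:
  assumes "v \<noteq> 0" "hermitian_matrix H"
  shows "((\<lambda>t::real. complex_of_real (ln (ip_norm ip (\<pi> (matrix_exp (t *\<^sub>R H)) v))))
       has_vector_derivative trace (moment_map ip \<pi> v ** H)) (at 0)"
  using moment_map_characterization[OF assms(1), THEN conjunct2, rule_format, OF assms(2)] .

text \<open>For nonzero \<open>w\<close> this is a probability distribution on the weights. Its expectation is, by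
  \<open>moment_map_pairing\<close>, the diagonal of the moment map.\<close>
definition weight_prob :: "'v \<Rightarrow> int^'n \<Rightarrow> real" where
  "weight_prob w \<omega> = (ip_norm ip (weight_part w \<omega>))\<^sup>2 / (ip_norm ip w)\<^sup>2"

lemma weight_prob_nonneg: "weight_prob w \<omega> \<ge> 0"
  by (simp add: weight_prob_def)

lemma weight_prob_sum: "w \<noteq> 0 \<Longrightarrow> (\<Sum>\<omega>\<in>weights smul \<pi>. weight_prob w \<omega>) = 1"
  using norm_pos[of w] unfolding weight_prob_def
  by (simp flip: sum_divide_distrib norm_weight_parts)

lemma norm_exp_diag_prob:
  assumes "w \<noteq> 0"
  shows "(ip_norm ip (\<pi> (exp_diag x) w))\<^sup>2 =
    (ip_norm ip w)\<^sup>2 * (\<Sum>\<omega>\<in>weights smul \<pi>. weight_prob w \<omega> * exp (2 * (real_vec \<omega> \<bullet> x)))"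
  using norm_pos[OF assms] unfolding weight_prob_def norm_exp_diag
  by (simp add: sum_distrib_left mult.commute)

text \<open>In coordinates that diagonalize the direction, the squared norm is a sum of exponentials, and
  its logarithmic derivative is a mean of the exponents. Both duality inequalities see the moment
  map through this formula.\<close>
theorem moment_map_pairing:
  assumes v: "v \<noteq> 0" and U: "unitary_matrix U"
  shows "moment_map ip \<pi> v \<bullet> (U ** real_diag x ** cadjoint U) =
     (\<Sum>\<omega>\<in>weights smul \<pi>. weight_prob (\<pi> (cadjoint U) v) \<omega> * (real_vec \<omega> \<bullet> x))"
proof -
  let ?H = "U ** real_diag x ** cadjoint U"
  let ?w = "\<pi> (cadjoint U) v"
  let ?S = "\<lambda>t. \<Sum>\<omega>\<in>weights smul \<pi>. weight_prob ?w \<omega> * exp (2 * (real_vec \<omega> \<bullet> (t *\<^sub>R x)))"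
  have w: "?w \<noteq> 0" using U v by (intro rep_nonzero) (simp_all add: unitary_invertible)
  have H: "hermitian_matrix ?H" by (rule hermitian_conjugated_real_diag)
  have eq: "ln (ip_norm ip (\<pi> (matrix_exp (t *\<^sub>R ?H)) v)) = ln (ip_norm ip ?w) + ln (?S t) / 2" for t
  proof -
    have 1: "ip_norm ip (\<pi> (matrix_exp (t *\<^sub>R ?H)) v) = ip_norm ip (\<pi> (exp_diag (t *\<^sub>R x)) ?w)"
      by (simp add: scaleR_conjugated_real_diag matrix_exp_diagonalized[OF U] rep_exp_conjugated[OF U])
    have pos: "ip_norm ip (\<pi> (exp_diag (t *\<^sub>R x)) ?w) > 0" "ip_norm ip ?w > 0"
      using w by (simp_all add: norm_pos rep_nonzero)
    have S: "(ip_norm ip (\<pi> (exp_diag (t *\<^sub>R x)) ?w))\<^sup>2 = (ip_norm ip ?w)\<^sup>2 * ?S t"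
      by (rule norm_exp_diag_prob[OF w])
    show ?thesis unfolding 1 by (rule ln_of_square_eq[OF pos S])
  qed
  have S0: "?S 0 = 1" using weight_prob_sum[OF w] by simp
  have S: "(?S has_field_derivative (\<Sum>\<omega>\<in>weights smul \<pi>. weight_prob ?w \<omega> * (2 * (real_vec \<omega> \<bullet> x)))) (at 0)"
    by (auto intro!: derivative_eq_intros sum.cong)
  have "((\<lambda>t. ln (ip_norm ip ?w) + ln (?S t) / 2) has_field_derivative
      (\<Sum>\<omega>\<in>weights smul \<pi>. weight_prob ?w \<omega> * (real_vec \<omega> \<bullet> x))) (at 0)"
    using half_ln_derivative[OF S S0 zero_less_one, of "ln (ip_norm ip ?w)"]
    by (simp add: sum_divide_distrib)
  then have "((\<lambda>t. complex_of_real (ln (ip_norm ip (\<pi> (matrix_exp (t *\<^sub>R ?H)) v)))) has_vector_derivative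
      of_real (\<Sum>\<omega>\<in>weights smul \<pi>. weight_prob ?w \<omega> * (real_vec \<omega> \<bullet> x))) (at 0)"
    unfolding eq by (rule has_vector_derivative_of_real)
  from vector_derivative_unique_at[OF this moment_map_derivative[OF v H]]
  show ?thesis
    unfolding trace_hermitian_mult[OF moment_map_hermitian[OF v] H] of_real_eq_iff by simp
qed

end

section \<open>Highest weights and the weight norm\<close>

context rational_unitary_rep
begin

text \<open>One Gram-Schmidt step per generator. The step divides by \<open>ip a2 a2\<close>; if \<open>a2 = 0\<close>, the quotient
  is 0 and nothing is to be corrected.\<close>
lemma orthogonal_decomposition_span:
  assumes "finite S"
  shows "\<exists>u z. w = u + z \<and> u \<in> span S \<and> (\<forall>s\<in>S. ip s z = 0)"
  using assms
proof (induction S arbitrary: w rule: finite_induct)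
  case (insert a S)
  obtain a1 a2 where a: "a = a1 + a2" "a1 \<in> span S" "\<forall>s\<in>S. ip s a2 = 0"
    using insert.IH by blast
  obtain u z where w: "w = u + z" "u \<in> span S" "\<forall>s\<in>S. ip s z = 0"
    using insert.IH by blast
  have span: "u' \<in> span (insert a S)" if "u' \<in> span S" for u'
    using that span_mono[of S "insert a S"] by auto
  have orth: "ip u' z' = 0" if "u' \<in> span S" "\<forall>s\<in>S. ip s z' = 0" for u' z'
  proof -
    have "subspace {s. ip s z' = 0}" by (simp add: subspace_def ip_add_left ip_scale_left)
    then show ?thesis using span_minimal[of S "{s. ip s z' = 0}"] that by auto
  qed
  let ?c = "ip a2 z / ip a2 a2"
  let ?z = "z - smul ?c a2"
  have "smul ?c a2 \<in> span (insert a S)"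
  proof -
    have "a2 = a - a1" using a by simp
    then have "a2 \<in> span (insert a S)" using span[OF a(2)] by (simp add: span_base span_diff)
    then show ?thesis by (rule span_scale)
  qed
  then have "u + smul ?c a2 \<in> span (insert a S)" using span[OF w(2)] by (rule span_add[rotated])
  moreover have z: "\<forall>s\<in>S. ip s ?z = 0" using a w by (simp add: ip_diff_right ip_scale_right)
  moreover have "ip a ?z = 0"
  proof -
    have "ip a2 ?z = 0" by (simp add: ip_diff_right ip_scale_right)
    then show ?thesis using orth[OF a(2) z] by (subst a(1)) (simp add: ip_add_left)
  qed
  moreover have "w = (u + smul ?c a2) + ?z" using w by simp
  ultimately show ?case by (intro exI[of _ "u + smul ?c a2"] exI[of _ ?z]) simp
qed auto

lemma orthogonal_decomposition:
  assumes "subspace U"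
  obtains u z where "w = u + z" "u \<in> U" "\<And>s. s \<in> U \<Longrightarrow> ip s z = 0"
proof -
  obtain S where S: "S \<subseteq> U" "independent S" "U \<subseteq> span S"
    by (rule basis_exists[of U]) blast
  have "finite S" using S(2) by (rule finiteI_independent)
  then obtain u z where uz: "w = u + z" "u \<in> span S" "\<forall>s\<in>S. ip s z = 0"
    using orthogonal_decomposition_span by blast
  have "u \<in> U" using uz(2) span_minimal[OF S(1) assms] by blast
  moreover have "ip s z = 0" if "s \<in> U" for s
  proof -
    have "subspace {s. ip s z = 0}" by (simp add: subspace_def ip_add_left ip_scale_left)
    then show ?thesis using span_minimal[of S "{s. ip s z = 0}"] uz(3) S(3) that by blast
  qed
  ultimately show ?thesis using that uz(1) by blast
qed

lemma subrep_subspace: "subrep smul \<pi> U \<Longrightarrow> subspace U"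
  by (simp add: subrep_def)

lemma subrep_rep: "subrep smul \<pi> U \<Longrightarrow> invertible g \<Longrightarrow> u \<in> U \<Longrightarrow> \<pi> g u \<in> U"
  unfolding subrep_def by blast

text \<open>The adjoint of \<open>\<pi> g\<close> is again the action of a group element, hence preserves \<open>U\<close>.\<close>
lemma subrep_orthogonal_complement:
  assumes U: "subrep smul \<pi> U" and W: "subrep smul \<pi> W"
  shows "subrep smul \<pi> {z \<in> W. \<forall>u\<in>U. ip u z = 0}"
  unfolding subrep_def
proof (intro conjI allI impI)
  show "subspace {z \<in> W. \<forall>u\<in>U. ip u z = 0}"
    using subrep_subspace[OF W] by (auto simp: subspace_def ip_add_right ip_scale_right)
  fix g :: "complex^'n^'n" assume g: "invertible g"
  have "ip u (\<pi> g z) = 0" if "u \<in> U" "\<forall>u\<in>U. ip u z = 0" for u z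
  proof -
    have "ip u (\<pi> g z) = ip (\<pi> (cadjoint g) u) z"
      using rep_adjoint[OF invertible_cadjoint[OF g], of u z] by simp
    then show ?thesis using that subrep_rep[OF U invertible_cadjoint[OF g]] by simp
  qed
  then show "\<pi> g ` {z \<in> W. \<forall>u\<in>U. ip u z = 0} \<subseteq> {z \<in> W. \<forall>u\<in>U. ip u z = 0}"
    using subrep_rep[OF W g] by auto
qed

text \<open>Take a subrepresentation \<open>W\<close> of least dimension among those that meet the weight space. For a
  subrepresentation \<open>U\<close> of \<open>W\<close> that does not meet it, the component of a weight vector orthogonal to
  \<open>U\<close> is a nonzero weight vector in the complement of \<open>U\<close>; by minimality the complement is \<open>W\<close>, and
  \<open>U\<close> is zero.\<close>
theorem weight_in_irreducible:
  assumes "\<omega> \<in> weights smul \<pi>"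
  obtains W w where "irreducible_subrep smul \<pi> W" "w \<in> W" "w \<in> weight_space \<omega>" "w \<noteq> 0"
proof -
  define Q where "Q W \<longleftrightarrow> subrep smul \<pi> W \<and> (\<exists>w\<in>W. w \<in> weight_space \<omega> \<and> w \<noteq> 0)" for W
  have "Q UNIV" using assms by (auto simp: Q_def subrep_def weights_iff)
  from ex_has_least_nat[of Q, OF this, of dim] obtain W where
    W: "Q W" and least: "\<And>W'. Q W' \<Longrightarrow> dim W \<le> dim W'" by blast
  have sub: "subrep smul \<pi> W" using W by (simp add: Q_def)
  obtain w where w: "w \<in> W" "w \<in> weight_space \<omega>" "w \<noteq> 0" using W by (auto simp: Q_def)
  have minimal: "W' = W" if "Q W'" "W' \<subseteq> W" for W'
  proof (rule subspace_dim_equal)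
    show "subspace W'" "subspace W" "W' \<subseteq> W" "dim W \<le> dim W'"
      using that sub least by (auto simp: Q_def subrep_def)
  qed
  have "U = {0} \<or> U = W" if U: "subrep smul \<pi> U" and UW: "U \<subseteq> W" for U
  proof (cases "Q U")
    case True
    then show ?thesis using minimal UW by blast
  next
    case False
    let ?C = "{z \<in> W. \<forall>u\<in>U. ip u z = 0}"
    have C: "subrep smul \<pi> ?C" by (rule subrep_orthogonal_complement[OF U sub])
    obtain u z where uz: "w = u + z" "u \<in> U" "\<And>s. s \<in> U \<Longrightarrow> ip s z = 0"
      by (rule orthogonal_decomposition[OF subrep_subspace[OF U], of w]) blast
    have "z = w - u" using uz(1) by simp
    then have "z \<in> ?C"
      using w(1) uz UW subspace_diff[OF subrep_subspace[OF sub], of w u] by auto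
    have "\<pi> (diag_matrix x) z = smul (torus_char \<omega> x) z" if x: "in_torus x" for x
    proof -
      have inv: "invertible (diag_matrix x)" using x by (rule diag_matrix_invertible)
      let ?d = "\<pi> (diag_matrix x) z - smul (torus_char \<omega> x) z"
      have "\<pi> (diag_matrix x) u + \<pi> (diag_matrix x) z = smul (torus_char \<omega> x) u + smul (torus_char \<omega> x) z"
        using weight_spaceD[OF w(2) x] inv by (simp add: uz(1) rep_add scale_right_distrib)
      then have "?d = smul (torus_char \<omega> x) u - \<pi> (diag_matrix x) u" by (simp add: algebra_simps)
      moreover have "smul (torus_char \<omega> x) u - \<pi> (diag_matrix x) u \<in> U"
        using subrep_rep[OF U inv uz(2)] subrep_subspace[OF U] uz(2)
        by (intro subspace_diff subspace_scale)
      moreover have "?d \<in> ?C"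
        by (rule subspace_diff[OF subrep_subspace[OF C] subrep_rep[OF C inv \<open>z \<in> ?C\<close>]
              subspace_scale[OF subrep_subspace[OF C] \<open>z \<in> ?C\<close>]])
      ultimately have "ip ?d ?d = 0" by auto
      then show ?thesis by simp
    qed
    then have "z \<in> weight_space \<omega>" by (simp add: weight_space_def)
    moreover have "z \<noteq> 0" using False U w uz by (auto simp: Q_def)
    ultimately have "Q ?C" using C \<open>z \<in> ?C\<close> unfolding Q_def by blast
    then have "?C = W" by (rule minimal) blast
    then have "ip u u = 0" if "u \<in> U" for u using UW that by blast
    then have "U \<subseteq> {0}" by auto
    then show ?thesis using subspace_0[OF subrep_subspace[OF U]] by blast
  qed
  then have "irreducible_subrep smul \<pi> W"
    using sub w unfolding irreducible_subrep_def by blast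
  then show ?thesis using that w by blast
qed

text \<open>The matrix of \<open>\<sigma>\<close> permutes the weight spaces. For an involution it is its own inverse.\<close>
lemma weights_permute:
  fixes \<sigma> :: "'n \<Rightarrow> 'n"
  assumes \<sigma>: "\<And>i. \<sigma> (\<sigma> i) = i" and "\<omega> \<in> weights smul \<pi>"
  shows "(\<chi> i. \<omega> $ \<sigma> i) \<in> weights smul \<pi>"
proof -
  obtain w where w: "w \<in> weight_space \<omega>" "w \<noteq> 0" using assms(2) by (auto simp: weights_iff)
  define P :: "complex^'n^'n" where "P = (\<chi> i j. if j = \<sigma> i then 1 else 0)"
  have left: "P ** A = (\<chi> i j. A $ \<sigma> i $ j)" for A :: "complex^'n^'n"
  proof -
    have "(P ** A) $ i $ j = (\<Sum>k\<in>UNIV. if k = \<sigma> i then A $ \<sigma> i $ j else 0)" for i j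
      unfolding matrix_matrix_mult_def P_def vec_lambda_beta by (intro sum.cong) auto
    then show ?thesis by (simp add: vec_eq_iff)
  qed
  have inv_iff: "k = \<sigma> i \<longleftrightarrow> i = \<sigma> k" for i k using \<sigma> by metis
  have PP: "P ** P = mat 1" unfolding left by (simp add: P_def vec_eq_iff mat_def \<sigma> eq_commute)
  then have P: "invertible P" unfolding invertible_def by blast
  have "\<pi> (diag_matrix y) (\<pi> P w) = smul (torus_char (\<chi> i. \<omega> $ \<sigma> i) y) (\<pi> P w)" if y: "in_torus y" for y
  proof -
    let ?x = "\<chi> i. y $ \<sigma> i"
    have x: "in_torus ?x" using y by simp
    have comm: "diag_matrix y ** P = P ** diag_matrix ?x"
    proof -
      have "(diag_matrix y ** P) $ i $ j = (P ** diag_matrix ?x) $ i $ j" for i j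
      proof -
        have "(diag_matrix y ** P) $ i $ j = (\<Sum>k\<in>UNIV. if k = i then y $ i * P $ i $ j else 0)"
          unfolding matrix_matrix_mult_def vec_lambda_beta by (intro sum.cong) auto
        then show ?thesis unfolding left by (auto simp: P_def \<sigma>)
      qed
      then show ?thesis by (simp add: vec_eq_iff)
    qed
    have "bij \<sigma>" using \<sigma> by (rule involuntory_imp_bij)
    then have "torus_char \<omega> ?x = (\<Prod>i\<in>UNIV. (y $ \<sigma> (\<sigma> i)) powi (\<omega> $ \<sigma> i))"
      unfolding torus_char_def
      by (subst prod.reindex_bij_betw[symmetric, where h = \<sigma> and S = UNIV and T = UNIV]) simp_all
    then have char: "torus_char \<omega> ?x = torus_char (\<chi> i. \<omega> $ \<sigma> i) y"
      by (simp add: \<sigma> torus_char_def)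
    have "\<pi> (diag_matrix y) (\<pi> P w) = \<pi> P (\<pi> (diag_matrix ?x) w)"
      using x y P by (simp add: rep_compose diag_matrix_invertible comm)
    then show ?thesis using x P w(1) by (simp add: weight_spaceD char rep_scale)
  qed
  then have "\<pi> P w \<in> weight_space (\<chi> i. \<omega> $ \<sigma> i)" by (simp add: weight_space_def)
  then show ?thesis using rep_nonzero[OF P w(2)] weights_iff by blast
qed

end

lemma real_vec_nth [simp]: "real_vec \<omega> $ i = real_of_int (\<omega> $ i)"
  by (simp add: real_vec_def)

lemma real_vec_diff: "real_vec (\<omega> - \<eta>) = real_vec \<omega> - real_vec \<eta>"
  by (simp add: vec_eq_iff)

lemma norm_real_vec_ge_1: "\<omega> \<noteq> 0 \<Longrightarrow> norm (real_vec \<omega>) \<ge> 1"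
proof -
  assume "\<omega> \<noteq> 0"
  then obtain i where "\<omega> $ i \<noteq> 0" by (auto simp: vec_eq_iff)
  then have "1 \<le> norm (real_vec \<omega> $ i)" by simp
  then show ?thesis using Finite_Cartesian_Product.norm_nth_le[of "real_vec \<omega>" i] by linarith
qed

text \<open>Highest weights refer to upper triangular matrices, so they need a linear order on the index
  type.\<close>
locale ordered_rational_unitary_rep = rational_unitary_rep smul B ip \<pi>
  for smul :: "complex \<Rightarrow> 'v::ab_group_add \<Rightarrow> 'v" and B :: "'v set"
    and ip :: "'v \<Rightarrow> 'v \<Rightarrow> complex"
    and \<pi> :: "complex^'n::{finite,wellorder}^'n::_ \<Rightarrow> 'v \<Rightarrow> 'v"
begin

text \<open>One of many vectors with strictly decreasing entries, used as a regular dominant direction.\<close>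
definition height :: "real^'n::_" where
  "height = (\<chi> i. real (card {j. i < j}))"

lemma height_decreasing: "i < j \<Longrightarrow> height $ j < height $ i"
  unfolding height_def by (auto intro!: psubset_card_mono)

text \<open>Among the weights of maximal norm take one that maximizes the pairing with \<open>height\<close>. If two of
  its entries increased, exchanging them would give a weight of the same norm with a larger pairing.\<close>
lemma maximal_dominant_weight:
  assumes "\<omega>0 \<in> weights smul \<pi>"
  obtains \<omega> where "\<omega> \<in> weights smul \<pi>" "norm (real_vec \<omega>0) \<le> norm (real_vec \<omega>)"
    "\<And>\<eta>. \<eta> \<in> weights smul \<pi> \<Longrightarrow> norm (real_vec \<eta>) \<le> norm (real_vec \<omega>)"
    "\<And>i j. i < j \<Longrightarrow> \<omega> $ j \<le> \<omega> $ i"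
proof -
  let ?\<Omega> = "weights smul \<pi>" and ?N = "\<lambda>\<omega>. norm (real_vec \<omega>)"
  define M where "M = Max (?N ` ?\<Omega>)"
  have le: "?N \<eta> \<le> M" if "\<eta> \<in> ?\<Omega>" for \<eta>
    unfolding M_def using that finite_weights by simp
  define T where "T = {\<omega> \<in> ?\<Omega>. ?N \<omega> = M}"
  have "M \<in> ?N ` ?\<Omega>" unfolding M_def using assms finite_weights by (intro Max_in) auto
  then have T: "finite T" "T \<noteq> {}" unfolding T_def using finite_weights by auto
  define R where "R = Max ((\<lambda>\<omega>. height \<bullet> real_vec \<omega>) ` T)"
  have "R \<in> (\<lambda>\<omega>. height \<bullet> real_vec \<omega>) ` T" unfolding R_def using T by (intro Max_in) auto
  then obtain \<omega> where \<omega>: "\<omega> \<in> T" "height \<bullet> real_vec \<omega> = R" by blast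
  have R: "height \<bullet> real_vec \<eta> \<le> R" if "\<eta> \<in> T" for \<eta>
    unfolding R_def using that T by simp
  have "\<omega> $ j \<le> \<omega> $ i" if ij: "i < j" for i j
  proof (rule ccontr)
    assume "\<not> \<omega> $ j \<le> \<omega> $ i"
    then have lt: "real_of_int (\<omega> $ i) < real_of_int (\<omega> $ j)" by simp
    define \<sigma> where "\<sigma> = Transposition.transpose i j"
    have \<sigma>: "\<sigma> (\<sigma> k) = k" for k by (simp add: \<sigma>_def)
    define \<eta> where "\<eta> = (\<chi> k. \<omega> $ \<sigma> k)"
    have "\<eta> \<in> ?\<Omega>" using weights_permute[OF \<sigma>] \<omega>(1) by (simp add: \<eta>_def T_def)
    moreover have "?N \<eta> = ?N \<omega>"
    proof -
      have "bij \<sigma>" using \<sigma> by (rule involuntory_imp_bij)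
      then have "(\<Sum>k\<in>UNIV. (real_of_int (\<omega> $ \<sigma> k))\<^sup>2) = (\<Sum>k\<in>UNIV. (real_of_int (\<omega> $ k))\<^sup>2)"
        by (rule sum.reindex_bij_betw)
      then show ?thesis by (simp add: norm_vec_def L2_set_def \<eta>_def)
    qed
    ultimately have "\<eta> \<in> T" using \<omega>(1) by (simp add: T_def)
    have "height \<bullet> real_vec \<eta> - height \<bullet> real_vec \<omega>
        = (\<Sum>k\<in>UNIV. height $ k * (real_of_int (\<omega> $ \<sigma> k) - real_of_int (\<omega> $ k)))"
      by (simp add: inner_vec_def \<eta>_def algebra_simps sum_subtractf)
    also have "\<dots> = (\<Sum>k\<in>{i, j}. height $ k * (real_of_int (\<omega> $ \<sigma> k) - real_of_int (\<omega> $ k)))"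
      by (rule sum.mono_neutral_right) (auto simp: \<sigma>_def transpose_def)
    also have "\<dots> = (height $ i - height $ j) * (real_of_int (\<omega> $ j) - real_of_int (\<omega> $ i))"
      using ij by (simp add: \<sigma>_def algebra_simps)
    also have "\<dots> > 0" using height_decreasing[OF ij] lt by (intro mult_pos_pos) auto
    finally show False using R[OF \<open>\<eta> \<in> T\<close>] \<omega>(2) by simp
  qed
  moreover have "\<omega> \<in> ?\<Omega>" "?N \<omega> = M" using \<omega>(1) by (auto simp: T_def)
  ultimately show ?thesis using that le assms by metis
qed

text \<open>A weight \<open>\<omega>\<close> of maximal norm is a vertex of the convex hull of the weights, exposed by \<open>\<omega>\<close>
  itself. A small multiple of \<open>height\<close> makes the functional strictly decreasing. The size
  of the multiple can be bounded because different integral vectors have distance at least 1.\<close>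
lemma separating_functional:
  assumes max: "\<And>\<eta>. \<eta> \<in> weights smul \<pi> \<Longrightarrow> norm (real_vec \<eta>) \<le> norm (real_vec \<omega>)"
    and dom: "\<And>i j. i < j \<Longrightarrow> \<omega> $ j \<le> \<omega> $ i"
  obtains \<rho> :: "real^'n::_" where "\<And>i j. i < j \<Longrightarrow> \<rho> $ j < \<rho> $ i"
    "\<And>\<eta>. \<eta> \<in> weights smul \<pi> \<Longrightarrow> \<eta> \<noteq> \<omega> \<Longrightarrow> real_vec \<eta> \<bullet> \<rho> < real_vec \<omega> \<bullet> \<rho>"
proof -
  define \<delta> where "\<delta> = 1 / (2 * norm height + 2)"
  have \<delta>: "\<delta> > 0" "\<delta> * norm height < 1 / 2"
  proof -
    have "2 * norm height + 2 > 0" using norm_ge_zero[of height] by linarith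
    then show "\<delta> > 0" "\<delta> * norm height < 1 / 2" by (simp_all add: \<delta>_def field_simps)
  qed
  define \<rho> where "\<rho> = real_vec \<omega> + \<delta> *\<^sub>R height"
  have "\<rho> $ j < \<rho> $ i" if "i < j" for i j
    using dom[OF that] height_decreasing[OF that] \<delta>(1) by (simp add: \<rho>_def add_le_less_mono)
  moreover have "real_vec \<eta> \<bullet> \<rho> < real_vec \<omega> \<bullet> \<rho>" if \<eta>: "\<eta> \<in> weights smul \<pi>" "\<eta> \<noteq> \<omega>" for \<eta>
  proof -
    define d where "d = real_vec \<eta> - real_vec \<omega>"
    have d1: "norm d \<ge> 1"
      using norm_real_vec_ge_1[of "\<eta> - \<omega>"] \<eta>(2) by (simp add: d_def real_vec_diff)
    have "(norm (real_vec \<eta>))\<^sup>2 \<le> (norm (real_vec \<omega>))\<^sup>2"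
      using max[OF \<eta>(1)] by (intro power_mono) auto
    moreover have "real_vec \<eta> = real_vec \<omega> + d" by (simp add: d_def)
    ultimately have "2 * (real_vec \<omega> \<bullet> d) \<le> - (norm d)\<^sup>2"
      by (simp add: power2_norm_eq_inner inner_add inner_commute)
    moreover have "2 * (\<delta> * (height \<bullet> d)) < (norm d)\<^sup>2"
    proof -
      have "\<delta> * (height \<bullet> d) \<le> \<delta> * (norm height * norm d)"
        using \<delta>(1) norm_cauchy_schwarz[of height d] by (intro mult_left_mono) auto
      also have "\<dots> = (\<delta> * norm height) * norm d" by simp
      also have "\<dots> < 1 / 2 * norm d" using \<delta>(2) d1 by (intro mult_strict_right_mono) auto
      also have "\<dots> \<le> 1 / 2 * (norm d)\<^sup>2" using mult_left_mono[OF d1, of "norm d"] by (simp add: power2_eq_square)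
      finally show ?thesis by simp
    qed
    ultimately have "\<rho> \<bullet> d < 0" by (simp add: \<rho>_def inner_add_left)
    then show ?thesis by (simp add: d_def inner_diff_right inner_commute)
  qed
  ultimately show ?thesis using that by blast
qed

text \<open>Conjugating \<open>b\<close> by \<open>exp(s \<rho>)\<close> multiplies the entry at \<open>(i, j)\<close> by \<open>exp(s (\<rho>\<^sub>j - \<rho>\<^sub>i))\<close>, so for
  upper triangular \<open>b\<close> and decreasing \<open>\<rho>\<close> the conjugates \<open>c s\<close> tend to the diagonal of \<open>b\<close> as \<open>s\<close>
  grows, and \<open>\<pi> (c s) w\<close> stays bounded. The same conjugation multiplies the component of
  \<open>u = \<pi> b w\<close> at a weight \<open>\<eta>\<close> by the exponential of \<open>s (\<omega> \<bullet> \<rho> - \<eta> \<bullet> \<rho>)\<close>, which is unbounded unless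
  \<open>\<eta> = \<omega>\<close>. Hence \<open>u\<close> has weight \<open>\<omega>\<close>, does not depend on \<open>s\<close>, and equals the limit. This
  argument on the group takes the place of raising operators on the Lie algebra.\<close>
theorem maximal_weight_borel_eigenvector:
  fixes b :: "complex^'n::_^'n::_"
  assumes max: "\<And>\<eta>. \<eta> \<in> weights smul \<pi> \<Longrightarrow> norm (real_vec \<eta>) \<le> norm (real_vec \<omega>)"
    and dom: "\<And>i j. i < j \<Longrightarrow> \<omega> $ j \<le> \<omega> $ i"
    and \<omega>: "\<omega> \<in> weights smul \<pi>"
    and w: "w \<in> weight_space \<omega>" and b: "invertible b" "upper_triangular_matrix b"
  shows "\<pi> b w = smul (torus_char \<omega> (\<chi> i. b $ i $ i)) w"
proof -
  obtain \<rho> :: "real^'n::_" where \<rho>: "\<And>i j. i < j \<Longrightarrow> \<rho> $ j < \<rho> $ i"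
    and sep: "\<And>\<eta>. \<eta> \<in> weights smul \<pi> \<Longrightarrow> \<eta> \<noteq> \<omega> \<Longrightarrow> real_vec \<eta> \<bullet> \<rho> < real_vec \<omega> \<bullet> \<rho>"
    using separating_functional[OF max dom] by blast
  let ?d = "\<chi> i. b $ i $ i"
  have "det b = (\<Prod>i\<in>UNIV. b $ i $ i)"
    using b(2) by (intro det_upperdiagonal) (auto simp: upper_triangular_matrix_def)
  then have d: "in_torus ?d" using b(1) by (simp add: invertible_det_nz)
  have dinv: "invertible (diag_matrix ?d)" by (rule diag_matrix_invertible[OF d])
  define c where "c s = exp_diag ((-s) *\<^sub>R \<rho>) ** b ** exp_diag (s *\<^sub>R \<rho>)" for s
  have c_inv: "invertible (c s)" for s unfolding c_def by (intro invertible_mult b) auto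
  have c_nth: "c s $ i $ j = of_real (exp (s * (\<rho> $ j - \<rho> $ i))) * b $ i $ j" for s i j
  proof -
    have 1: "(exp_diag x ** A) $ i $ j = of_real (exp (x $ i)) * A $ i $ j" for x i j and A :: "complex^'n::_^'n::_"
    proof -
      have "(exp_diag x ** A) $ i $ j = (\<Sum>k\<in>UNIV. if k = i then of_real (exp (x $ i)) * A $ i $ j else 0)"
        unfolding matrix_matrix_mult_def exp_diag_def vec_lambda_beta by (intro sum.cong) auto
      then show ?thesis by simp
    qed
    have 2: "(A ** exp_diag x) $ i $ j = A $ i $ j * of_real (exp (x $ j))" for x i j and A :: "complex^'n::_^'n::_"
    proof -
      have "(A ** exp_diag x) $ i $ j = (\<Sum>k\<in>UNIV. if k = j then A $ i $ j * of_real (exp (x $ j)) else 0)"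
        unfolding matrix_matrix_mult_def exp_diag_def vec_lambda_beta by (intro sum.cong) auto
      then show ?thesis by simp
    qed
    show ?thesis unfolding c_def
      by (simp add: 1 2 algebra_simps exp_diff exp_minus flip: of_real_mult exp_add) (simp add: field_simps)
  qed
  have lim_c: "(c \<longlongrightarrow> diag_matrix ?d) at_top"
  proof (intro vec_tendstoI)
    fix i j :: 'n
    consider "i = j" | "j < i" | "i < j" using linorder_less_linear[of i j] by (elim disjE)
    then show "((\<lambda>s. c s $ i $ j) \<longlongrightarrow> diag_matrix ?d $ i $ j) at_top"
    proof cases
      case 3
      then have "\<rho> $ j - \<rho> $ i < 0" using \<rho> by simp
      from filterlim_tendsto_neg_mult_at_bot[OF tendsto_const this filterlim_ident]
      have "filterlim (\<lambda>s. s * (\<rho> $ j - \<rho> $ i)) at_bot at_top" by (simp add: mult.commute)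
      then have "((\<lambda>s. exp (s * (\<rho> $ j - \<rho> $ i))) \<longlongrightarrow> 0) at_top"
        by (rule filterlim_compose[OF exp_at_bot])
      then have "((\<lambda>s. of_real (exp (s * (\<rho> $ j - \<rho> $ i))) * b $ i $ j) \<longlongrightarrow> of_real 0 * b $ i $ j) at_top"
        by (intro tendsto_intros)
      with 3 show ?thesis by (simp add: c_nth)
    qed (use b(2) in \<open>auto simp: c_nth upper_triangular_matrix_def\<close>)
  qed
  define u where "u = \<pi> b w"
  have act: "\<pi> (c s) w = smul (of_real (exp (s * (real_vec \<omega> \<bullet> \<rho>)))) (\<pi> (exp_diag ((-s) *\<^sub>R \<rho>)) u)" for s
  proof -
    have "\<pi> (c s) w = \<pi> (exp_diag ((-s) *\<^sub>R \<rho>)) (\<pi> b (\<pi> (exp_diag (s *\<^sub>R \<rho>)) w))"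
      using b(1) by (simp add: c_def rep_compose invertible_mult matrix_mul_assoc)
    then show ?thesis using b(1) by (simp add: weight_space_exp_diag[OF w] rep_scale u_def)
  qed
  have lim: "((\<lambda>s. ip y (\<pi> (c s) w)) \<longlongrightarrow> ip y (smul (torus_char \<omega> ?d) w)) at_top" for y
  proof -
    obtain p where "rational_fun p" and p: "\<And>g. invertible g \<Longrightarrow> ip y (\<pi> g w) = p g"
      using matrix_coefficient_rational by blast
    then have "isCont p (diag_matrix ?d)"
      using dinv differentiable_imp_continuous_within rational_fun_differentiable by blast
    then have "((\<lambda>s. p (c s)) \<longlongrightarrow> p (diag_matrix ?d)) at_top"
      using lim_c by (rule isCont_tendsto_compose)
    then show ?thesis using weight_spaceD[OF w d] by (simp add: p[OF c_inv] flip: p[OF dinv])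
  qed
  have zero: "weight_part u \<eta> = 0" if \<eta>: "\<eta> \<in> weights smul \<pi>" "\<eta> \<noteq> \<omega>" for \<eta>
  proof (rule ccontr)
    assume ne: "weight_part u \<eta> \<noteq> 0"
    let ?y = "weight_part u \<eta>"
    let ?k = "real_vec \<omega> \<bullet> \<rho> - real_vec \<eta> \<bullet> \<rho>"
    have "ip ?y (\<pi> (c s) w) = of_real (exp (s * ?k) * Re (ip ?y ?y))" for s
    proof -
      have "ip ?y u = (\<Sum>\<theta>\<in>weights smul \<pi>. ip ?y (weight_part u \<theta>))"
        by (simp add: weight_part_sum flip: ip_sum_right)
      also have "\<dots> = (\<Sum>\<theta>\<in>weights smul \<pi>. if \<theta> = \<eta> then ip ?y ?y else 0)"
        by (intro sum.cong refl) (auto simp: weight_spaces_orthogonal[OF weight_part_in weight_part_in])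
      also have "\<dots> = ip ?y ?y" using \<eta>(1) finite_weights by simp
      also have "\<dots> = of_real (Re (ip ?y ?y))" by (simp add: complex_eq_iff)
      finally have yu: "ip ?y u = of_real (Re (ip ?y ?y))" .
      have "ip ?y (\<pi> (exp_diag ((-s) *\<^sub>R \<rho>)) u)
          = of_real (exp (- s * (real_vec \<eta> \<bullet> \<rho>))) * of_real (Re (ip ?y ?y))"
        by (simp add: exp_diag_self_adjoint[symmetric] weight_space_exp_diag[OF weight_part_in]
            ip_scale_left yu)
      then have "ip ?y (\<pi> (c s) w) = of_real (exp (s * (real_vec \<omega> \<bullet> \<rho>)) *
          (exp (- s * (real_vec \<eta> \<bullet> \<rho>)) * Re (ip ?y ?y)))"
        by (simp only: act ip_scale_right of_real_mult)
      also have "exp (s * (real_vec \<omega> \<bullet> \<rho>)) * (exp (- s * (real_vec \<eta> \<bullet> \<rho>)) * Re (ip ?y ?y))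
          = exp (s * ?k) * Re (ip ?y ?y)"
        by (simp add: algebra_simps flip: exp_add mult.assoc)
      finally show ?thesis .
    qed
    then have "((\<lambda>s. exp (s * ?k) * Re (ip ?y ?y)) \<longlongrightarrow>
        Re (ip ?y (smul (torus_char \<omega> ?d) w))) at_top"
      using tendsto_Re[OF lim[of ?y]] by simp
    moreover have "filterlim (\<lambda>s. exp (s * ?k) * Re (ip ?y ?y)) at_top at_top"
    proof -
      have "?k > 0" using sep[OF \<eta>] by simp
      from filterlim_tendsto_pos_mult_at_top[OF tendsto_const this filterlim_ident]
      have "filterlim (\<lambda>s. s * ?k) at_top at_top" by (simp only: mult.commute)
      then have "filterlim (\<lambda>s. exp (s * ?k)) at_top at_top" by (rule filterlim_compose[OF exp_at_top])
      from filterlim_tendsto_pos_mult_at_top[OF tendsto_const ip_pos[OF ne] this]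
      show ?thesis by (simp only: mult.commute)
    qed
    ultimately show False
      using not_tendsto_and_filterlim_at_infinity[OF trivial_limit_at_top_linorder]
        filterlim_at_top_imp_at_infinity by blast
  qed
  have u: "u \<in> weight_space \<omega>"
  proof -
    have "u = (\<Sum>\<eta>\<in>weights smul \<pi>. if \<eta> = \<omega> then weight_part u \<omega> else 0)"
      by (subst (1) weight_part_sum[symmetric]) (intro sum.cong, auto simp: zero)
    then show ?thesis using \<omega> finite_weights weight_part_in[of u \<omega>] by simp
  qed
  have "\<pi> (c s) w = u" for s
    unfolding act weight_space_exp_diag[OF u] by (simp add: exp_minus flip: of_real_mult exp_add)
  then have "ip y u = ip y (smul (torus_char \<omega> ?d) w)" for y
    using lim[of y] by (simp add: tendsto_const_iff)
  then show ?thesis unfolding u_def by (rule eq_by_ip)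
qed

text \<open>A dominant weight of maximal norm occurs in an irreducible subrepresentation and is its highest
  weight, so the largest norm of a highest weight is the largest norm of any weight.\<close>
theorem weight_norm_bound:
  assumes "\<omega>0 \<in> weights smul \<pi>"
  shows "norm (real_vec \<omega>0) \<le> weight_norm smul \<pi>"
proof -
  let ?S = "{norm (real_vec l) | l W. irreducible_subrep smul \<pi> W \<and> is_highest_weight smul \<pi> W l}"
  \<comment> \<open>Highest weights are weights; as there are finitely many, the maximum in the weight norm exists.\<close>
  have "l \<in> weights smul \<pi>" if hw: "is_highest_weight smul \<pi> W l" for W l
  proof -
    obtain w where "w \<noteq> 0" and w: "\<forall>b. invertible b \<and> upper_triangular_matrix b \<longrightarrow>
       \<pi> b w = smul (\<Prod>i\<in>UNIV. (b $ i $ i) powi (l $ i)) w"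
      using hw unfolding is_highest_weight_def by blast
    have "\<pi> (diag_matrix x) w = smul (torus_char l x) w" if x: "in_torus x" for x
      using w[rule_format, of "diag_matrix x"] diag_matrix_invertible[OF x]
      by (simp add: upper_triangular_matrix_def torus_char_def)
    then have "w \<in> weight_space l" by (simp add: weight_space_def)
    then show ?thesis using \<open>w \<noteq> 0\<close> weights_iff by blast
  qed
  then have "?S \<subseteq> (\<lambda>l. norm (real_vec l)) ` weights smul \<pi>" by blast
  then have fin: "finite ?S" using finite_weights finite_subset by blast
  obtain \<omega> where \<omega>: "\<omega> \<in> weights smul \<pi>" "norm (real_vec \<omega>0) \<le> norm (real_vec \<omega>)"
    and max: "\<And>\<eta>. \<eta> \<in> weights smul \<pi> \<Longrightarrow> norm (real_vec \<eta>) \<le> norm (real_vec \<omega>)"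
    and dom: "\<And>i j. i < j \<Longrightarrow> \<omega> $ j \<le> \<omega> $ i"
    using maximal_dominant_weight[OF assms] by blast
  obtain W w where W: "irreducible_subrep smul \<pi> W" "w \<in> W" "w \<in> weight_space \<omega>" "w \<noteq> 0"
    using weight_in_irreducible[OF \<omega>(1)] .
  have "is_highest_weight smul \<pi> W \<omega>"
    unfolding is_highest_weight_def
    using maximal_weight_borel_eigenvector[OF max dom \<omega>(1) W(3)] W(2,4)
    by (intro bexI[of _ w]) (auto simp: torus_char_def)
  then have "norm (real_vec \<omega>) \<in> ?S" using W(1) by blast
  then have "norm (real_vec \<omega>) \<le> weight_norm smul \<pi>"
    unfolding weight_norm_def using fin by (rule Max_ge[rotated])
  then show ?thesis using \<omega>(2) by simp
qed

end

section \<open>The two duality inequalities\<close>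

lemma exp_quadratic_bound:
  fixes y :: real
  assumes "\<bar>y\<bar> \<le> 1"
  shows "exp y \<le> 1 + y + y\<^sup>2"
proof (cases "y \<ge> 0")
  case True
  then show ?thesis using assms by (intro exp_bound) auto
next
  case False
  define z where "z = - y"
  have z: "0 < z" using False by (simp add: z_def)
  have "1 + z \<le> exp z" by (rule exp_ge_add_one_self)
  then have "exp y \<le> 1 / (1 + z)" using z by (simp add: z_def exp_minus field_simps)
  also have "\<dots> \<le> 1 - z + z\<^sup>2"
  proof -
    have "(1 - z + z\<^sup>2) * (1 + z) = 1 + z ^ 3" by (simp add: algebra_simps power2_eq_square power3_eq_cube)
    moreover have "z ^ 3 > 0" using z by simp
    ultimately have "1 \<le> (1 - z + z\<^sup>2) * (1 + z)" by linarith
    then show ?thesis using z by (simp add: pos_divide_le_eq)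
  qed
  finally show ?thesis by (simp add: z_def)
qed

context rational_unitary_rep
begin

lemma weights_nonempty: "(v::'v) \<noteq> 0 \<Longrightarrow> weights smul \<pi> \<noteq> {}"
  using weight_part_sum[of v] by auto

text \<open>Move along \<open>exp(- t M)\<close> for the moment map \<open>M\<close>. If \<open>x\<close> are the eigenvalues of \<open>M\<close>, then
  \<open>a \<omega> = \<omega> \<bullet> x\<close> has mean \<open>|x|\<^sup>2 = |M|\<^sup>2\<close>, because \<open>M\<close> is paired with itself, and is bounded by
  \<open>R |x|\<close>. The first part compares mean and bound. For the second, the quadratic bound for the
  exponential gives the factor \<open>1 - 2 t |x|\<^sup>2 + 4 t\<^sup>2 R\<^sup>2 |x|\<^sup>2\<close>, which is least at \<open>t = 1 / (4 R\<^sup>2)\<close>.\<close>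
lemma moment_map_steepest_descent:
  assumes v: "v \<noteq> 0" and R: "\<And>\<omega>. \<omega> \<in> weights smul \<pi> \<Longrightarrow> norm (real_vec \<omega>) \<le> R"
  shows "norm (moment_map ip \<pi> v) \<le> R"
    and "R > 0 \<Longrightarrow> \<exists>h. invertible h \<and>
      (ip_norm ip (\<pi> h v))\<^sup>2 \<le> (ip_norm ip v)\<^sup>2 * (1 - (norm (moment_map ip \<pi> v))\<^sup>2 / (4 * R\<^sup>2))"
proof -
  let ?M = "moment_map ip \<pi> v"
  let ?\<Omega> = "weights smul \<pi>"
  obtain U x where U: "unitary_matrix U" and x: "?M = U ** real_diag x ** cadjoint U"
    using hermitian_spectral[OF moment_map_hermitian[OF v]] .
  have Mx: "norm ?M = norm x" unfolding x by (rule norm_diagonalized[OF U])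
  let ?w = "\<pi> (cadjoint U) v"
  have inv: "invertible (cadjoint U)" using U by (simp add: unitary_invertible)
  have w: "?w \<noteq> 0" by (rule rep_nonzero[OF inv v])
  have nw: "ip_norm ip ?w = ip_norm ip v" using U by (simp add: rep_unitary_norm)
  define p where "p = weight_prob ?w"
  define a where "a \<omega> = real_vec \<omega> \<bullet> x" for \<omega>
  have p0: "p \<omega> \<ge> 0" for \<omega> by (simp add: p_def weight_prob_nonneg)
  have p1: "sum p ?\<Omega> = 1" unfolding p_def by (rule weight_prob_sum[OF w])
  have mean: "(\<Sum>\<omega>\<in>?\<Omega>. p \<omega> * a \<omega>) = (norm x)\<^sup>2"
    using moment_map_pairing[OF v U, of x]
    by (simp add: p_def a_def x[symmetric] power2_norm_eq_inner[symmetric] Mx)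
  have a: "\<bar>a \<omega>\<bar> \<le> R * norm x" if "\<omega> \<in> ?\<Omega>" for \<omega>
    using Cauchy_Schwarz_ineq2[of "real_vec \<omega>" x] mult_right_mono[OF R[OF that] norm_ge_zero[of x]]
    by (simp add: a_def)
  have "(norm x)\<^sup>2 \<le> (\<Sum>\<omega>\<in>?\<Omega>. p \<omega> * (R * norm x))"
    unfolding mean[symmetric] using a p0 by (intro sum_mono mult_left_mono) (auto simp: abs_le_iff)
  also have "\<dots> = R * norm x" using p1 by (simp flip: sum_distrib_right)
  finally have xR': "norm x * norm x \<le> R * norm x" by (simp add: power2_eq_square)
  obtain \<omega>0 where "\<omega>0 \<in> ?\<Omega>" using weights_nonempty[OF v] by blast
  then have "0 \<le> R" using R order_trans[OF norm_ge_zero] by blast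
  then have xR: "norm x \<le> R"
    using xR' by (cases "norm x = 0") auto
  then show "norm ?M \<le> R" by (simp add: Mx)
  assume "R > 0"
  define t where "t = 1 / (4 * R\<^sup>2)"
  have t: "t > 0" "4 * t * R\<^sup>2 = 1" using \<open>R > 0\<close> by (simp_all add: t_def)
  let ?h = "exp_diag ((-t) *\<^sub>R x) ** cadjoint U"
  have bound: "exp (2 * (real_vec \<omega> \<bullet> ((-t) *\<^sub>R x))) \<le> 1 - 2 * t * a \<omega> + 4 * t\<^sup>2 * (R\<^sup>2 * (norm x)\<^sup>2)"
    if \<omega>: "\<omega> \<in> ?\<Omega>" for \<omega>
  proof -
    have "\<bar>2 * t * a \<omega>\<bar> = 2 * t * \<bar>a \<omega>\<bar>" using t by (simp add: abs_mult)
    also have "\<dots> \<le> 2 * t * (R * norm x)" using a[OF \<omega>] t(1) by (intro mult_left_mono) auto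
    also have "\<dots> \<le> 2 * t * (R * R)" using xR \<open>R > 0\<close> t(1) by (intro mult_left_mono) auto
    also have "\<dots> \<le> 1" using t(2) by (simp add: power2_eq_square)
    finally have "\<bar>- (2 * t * a \<omega>)\<bar> \<le> 1" by simp
    from exp_quadratic_bound[OF this]
    have "exp (- (2 * t * a \<omega>)) \<le> 1 - 2 * t * a \<omega> + 4 * t\<^sup>2 * (a \<omega>)\<^sup>2"
      by (simp add: power_mult_distrib)
    also have "(a \<omega>)\<^sup>2 \<le> (R * norm x)\<^sup>2"
      using a[OF \<omega>] by (intro abs_le_square_iff[THEN iffD1]) auto
    finally show ?thesis
      by (simp add: a_def power_mult_distrib mult_left_mono mult.assoc)
  qed
  have "(ip_norm ip (\<pi> ?h v))\<^sup>2 = (ip_norm ip (\<pi> (exp_diag ((-t) *\<^sub>R x)) ?w))\<^sup>2"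
    using inv by (simp only: rep_compose invertible_exp_diag)
  also have "\<dots> = (ip_norm ip v)\<^sup>2 * (\<Sum>\<omega>\<in>?\<Omega>. p \<omega> * exp (2 * (real_vec \<omega> \<bullet> ((-t) *\<^sub>R x))))"
    unfolding norm_exp_diag_prob[OF w] nw p_def ..
  also have "\<dots> \<le> (ip_norm ip v)\<^sup>2 *
      (\<Sum>\<omega>\<in>?\<Omega>. p \<omega> * (1 - 2 * t * a \<omega> + 4 * t\<^sup>2 * (R\<^sup>2 * (norm x)\<^sup>2)))"
    by (intro mult_left_mono sum_mono bound p0) auto
  also have "(\<Sum>\<omega>\<in>?\<Omega>. p \<omega> * (1 - 2 * t * a \<omega> + 4 * t\<^sup>2 * (R\<^sup>2 * (norm x)\<^sup>2)))
      = sum p ?\<Omega> - 2 * t * (\<Sum>\<omega>\<in>?\<Omega>. p \<omega> * a \<omega>) + sum p ?\<Omega> * (4 * t\<^sup>2 * (R\<^sup>2 * (norm x)\<^sup>2))"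
    by (simp add: distrib_left right_diff_distrib sum.distrib sum_subtractf sum_distrib_left
        sum_distrib_right mult_ac)
  also have "\<dots> = 1 - 2 * t * (norm x)\<^sup>2 + t * (4 * t * R\<^sup>2) * (norm x)\<^sup>2"
    by (simp add: p1 mean power2_eq_square)
  also have "\<dots> = 1 - (norm x)\<^sup>2 / (4 * R\<^sup>2)" by (simp only: t(2)) (simp add: t_def)
  finally have "(ip_norm ip (\<pi> ?h v))\<^sup>2 \<le> (ip_norm ip v)\<^sup>2 * (1 - (norm ?M)\<^sup>2 / (4 * R\<^sup>2))"
    by (simp add: Mx)
  then show "\<exists>h. invertible h \<and>
      (ip_norm ip (\<pi> h v))\<^sup>2 \<le> (ip_norm ip v)\<^sup>2 * (1 - (norm ?M)\<^sup>2 / (4 * R\<^sup>2))"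
    using inv by (intro exI[of _ ?h]) (auto intro: invertible_mult)
qed

lemma capacity_le: "invertible h \<Longrightarrow> capacity ip \<pi> v \<le> ip_norm ip (\<pi> h v)"
  unfolding capacity_def by (intro cINF_lower bdd_belowI2[of _ 0]) (auto simp: norm_nonneg)

lemma capacity_greatest:
  assumes "\<And>h. invertible h \<Longrightarrow> c \<le> ip_norm ip (\<pi> h v)"
  shows "c \<le> capacity ip \<pi> v"
proof -
  have "invertible (mat 1 :: complex^'n^'n)" unfolding invertible_def by (intro exI[of _ "mat 1"]) simp
  then show ?thesis unfolding capacity_def using assms by (intro cINF_greatest) auto
qed

lemma capacity_pos_nonzero:
  assumes "capacity ip \<pi> v > 0" shows "v \<noteq> 0"
proof
  assume "v = 0"
  have "invertible (mat 1 :: complex^'n^'n)" unfolding invertible_def by (intro exI[of _ "mat 1"]) simp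
  from capacity_le[OF this, of v] show False using assms \<open>v = 0\<close> by (simp add: ip_norm_def)
qed

text \<open>The descent step cannot lead below the capacity. So the squared norm exceeds the squared
  capacity at least by the factor \<open>1 / (1 - q)\<close>, whose logarithm is at least \<open>q\<close>.\<close>
theorem minimizing_implies_scaling:
  assumes cap: "capacity ip \<pi> v > 0" and g: "invertible g"
    and R: "\<And>\<omega>. \<omega> \<in> weights smul \<pi> \<Longrightarrow> norm (real_vec \<omega>) \<le> R"
    and gap: "ln (ip_norm ip (\<pi> g v)) - ln (capacity ip \<pi> v) \<le> \<epsilon>"
  shows "norm (moment_map ip \<pi> (\<pi> g v)) \<le> R * sqrt (8 * \<epsilon>)"
proof -
  let ?w = "\<pi> g v" and ?c = "capacity ip \<pi> v"
  let ?m = "norm (moment_map ip \<pi> ?w)"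
  have w: "?w \<noteq> 0" by (rule rep_nonzero[OF g capacity_pos_nonzero[OF cap]])
  have m: "?m \<le> R" by (rule moment_map_steepest_descent(1)[OF w R])
  then have "0 \<le> R" using norm_ge_zero order_trans by blast
  show ?thesis
  proof (cases "R = 0")
    case True
    then show ?thesis using m by simp
  next
    case False
    then have Rpos: "R > 0" using \<open>0 \<le> R\<close> by simp
    define q where "q = ?m\<^sup>2 / (4 * R\<^sup>2)"
    obtain h where h: "invertible h" and le: "(ip_norm ip (\<pi> h ?w))\<^sup>2 \<le> (ip_norm ip ?w)\<^sup>2 * (1 - q)"
      using moment_map_steepest_descent(2)[OF w R Rpos] unfolding q_def by blast
    have n: "ip_norm ip ?w > 0" by (rule norm_pos[OF w])
    have "?c \<le> ip_norm ip (\<pi> h ?w)"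
      using capacity_le[OF invertible_mult[OF h g], of v] by (simp add: rep_compose h g)
    then have "?c\<^sup>2 \<le> (ip_norm ip (\<pi> h ?w))\<^sup>2" using cap by (intro power_mono) auto
    then have c2: "?c\<^sup>2 \<le> (ip_norm ip ?w)\<^sup>2 * (1 - q)" using le by simp
    have "0 < ?c\<^sup>2" using cap by simp
    also note c2
    finally have q: "1 - q > 0" using n by (simp add: zero_less_mult_iff)
    have "2 * ln ?c = ln (?c\<^sup>2)" using cap by (simp add: ln_realpow)
    also have "\<dots> \<le> ln ((ip_norm ip ?w)\<^sup>2 * (1 - q))"
      using c2 cap n q by (subst ln_le_cancel_iff) auto
    also have "\<dots> = 2 * ln (ip_norm ip ?w) + ln (1 - q)"
      using n q by (simp add: ln_mult ln_realpow)
    also have "ln (1 - q) \<le> - q" using ln_le_minus_one[OF q] by simp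
    finally have "q \<le> 2 * \<epsilon>" using gap by simp
    then have "?m\<^sup>2 \<le> R\<^sup>2 * (8 * \<epsilon>)" using Rpos by (simp add: q_def field_simps)
    then have "sqrt (?m\<^sup>2) \<le> sqrt (R\<^sup>2 * (8 * \<epsilon>))" by (rule real_sqrt_le_mono)
    then show ?thesis using Rpos by (simp add: real_sqrt_mult)
  qed
qed

end

text \<open>Induction on the support \<open>\<Gamma>\<close> of the masses \<open>s\<close>. If 0 lies in the convex hull of \<open>f ` \<Gamma>\<close>,
  subtract from \<open>s\<close> the largest possible multiple \<open>\<delta>\<close> of convex coefficients \<open>c\<close> of 0. This removes
  a point of the support and does not change the first moment; the total mass drops by \<open>\<delta>\<close>, and the
  exponential sum at least by \<open>\<delta>\<close>, by Jensen's inequality for \<open>c\<close>. If 0 is not in the hull, the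
  margin bounds the mass of \<open>s\<close> by \<open>\<kappa>\<close> times the norm of the first moment, and the left-hand side is
  not positive.\<close>
lemma exponential_sum_lower_bound:
  fixes f :: "'i \<Rightarrow> 'a::euclidean_space" and \<kappa> :: real
  assumes "finite \<Omega>" "inj_on f \<Omega>" "\<kappa> \<ge> 0"
    and margin: "\<And>\<Gamma>. \<Gamma> \<noteq> {} \<Longrightarrow> \<Gamma> \<subseteq> \<Omega> \<Longrightarrow> 0 \<notin> convex hull (f ` \<Gamma>) \<Longrightarrow>
      1 \<le> \<kappa> * infdist 0 (convex hull (f ` \<Gamma>))"
    and "\<And>i. i \<in> \<Omega> \<Longrightarrow> s i \<ge> 0"
  shows "sum s \<Omega> - \<kappa> * norm (\<Sum>i\<in>\<Omega>. s i *\<^sub>R f i) \<le> (\<Sum>i\<in>\<Omega>. s i * exp (f i \<bullet> x))"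
  using assms(5)
proof (induction "card {i\<in>\<Omega>. s i > 0}" arbitrary: s rule: less_induct)
  case less
  define \<Gamma> where "\<Gamma> = {i\<in>\<Omega>. s i > 0}"
  have \<Gamma>: "\<Gamma> \<subseteq> \<Omega>" "finite \<Gamma>" using \<open>finite \<Omega>\<close> by (auto simp: \<Gamma>_def)
  have zero: "s i = 0" if "i \<in> \<Omega> - \<Gamma>" for i using less.prems[of i] that by (auto simp: \<Gamma>_def)
  have mass: "sum s \<Omega> = sum s \<Gamma>"
    by (rule sum.mono_neutral_right) (use \<open>finite \<Omega>\<close> \<Gamma> zero in auto)
  have moment: "(\<Sum>i\<in>\<Omega>. s i *\<^sub>R f i) = (\<Sum>i\<in>\<Gamma>. s i *\<^sub>R f i)"
    by (rule sum.mono_neutral_right) (use \<open>finite \<Omega>\<close> \<Gamma> zero in auto)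
  have nonneg: "(\<Sum>i\<in>\<Omega>. s i * exp (f i \<bullet> x)) \<ge> 0"
    using less.prems by (intro sum_nonneg mult_nonneg_nonneg) auto
  consider "\<Gamma> = {}" | "\<Gamma> \<noteq> {}" "0 \<notin> convex hull (f ` \<Gamma>)" | "\<Gamma> \<noteq> {}" "0 \<in> convex hull (f ` \<Gamma>)" by blast
  then show ?case
  proof cases
    case 1
    then show ?thesis using nonneg mass moment by simp
  next
    case 2
    define m where "m = sum s \<Gamma>"
    have m: "m > 0" unfolding m_def by (rule sum_pos) (use 2 \<Gamma> in \<open>auto simp: \<Gamma>_def\<close>)
    let ?q = "\<Sum>i\<in>\<Gamma>. s i *\<^sub>R f i"
    have "(\<Sum>i\<in>\<Gamma>. (s i / m) *\<^sub>R f i) \<in> convex hull (f ` \<Gamma>)"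
      using \<Gamma> m by (intro convex_sum convex_convex_hull)
        (auto simp: \<Gamma>_def hull_inc m_def simp flip: sum_divide_distrib)
    moreover have "(\<Sum>i\<in>\<Gamma>. (s i / m) *\<^sub>R f i) = (1 / m) *\<^sub>R ?q"
      by (simp add: scaleR_sum_right)
    ultimately have "infdist 0 (convex hull (f ` \<Gamma>)) \<le> dist 0 ((1 / m) *\<^sub>R ?q)"
      by (intro infdist_le) simp
    then have "\<kappa> * infdist 0 (convex hull (f ` \<Gamma>)) \<le> \<kappa> * (norm ?q / m)"
      using m \<open>\<kappa> \<ge> 0\<close> by (intro mult_left_mono) auto
    then have "1 \<le> \<kappa> * (norm ?q / m)" using margin[OF 2(1) \<Gamma>(1) 2(2)] by linarith
    then have "m \<le> \<kappa> * norm ?q" using m by (simp add: field_simps)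
    then show ?thesis using nonneg mass moment by (simp add: m_def)
  next
    case 3
    have inj: "inj_on f \<Gamma>" using assms(2) \<Gamma>(1) inj_on_subset by blast
    obtain u where u: "\<forall>y\<in>f ` \<Gamma>. 0 \<le> u y" "sum u (f ` \<Gamma>) = 1" "(\<Sum>y\<in>f ` \<Gamma>. u y *\<^sub>R y) = 0"
      using 3(2) \<Gamma>(2) by (auto simp: convex_hull_finite)
    define c where "c i = (if i \<in> \<Gamma> then u (f i) else 0)" for i
    have c0: "c i \<ge> 0" for i using u(1) by (simp add: c_def)
    have "sum c \<Gamma> = 1" using u(2) inj by (simp add: sum.reindex c_def)
    then have c1: "sum c \<Omega> = 1"
      using \<open>finite \<Omega>\<close> \<Gamma> by (subst sum.mono_neutral_right[of \<Omega> \<Gamma>]) (auto simp: c_def)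
    have "(\<Sum>i\<in>\<Gamma>. c i *\<^sub>R f i) = 0" using u(3) inj by (simp add: sum.reindex c_def)
    then have cf: "(\<Sum>i\<in>\<Omega>. c i *\<^sub>R f i) = 0"
      using \<open>finite \<Omega>\<close> \<Gamma> by (subst sum.mono_neutral_right[of \<Omega> \<Gamma>]) (auto simp: c_def)
    \<comment> \<open>The largest admissible multiple is attained at some \<open>k\<close>, where \<open>s'\<close> vanishes.\<close>
    define P where "P = {i\<in>\<Gamma>. c i > 0}"
    have P: "finite P" using \<Gamma> by (simp add: P_def)
    have "P \<noteq> {}"
    proof
      assume "P = {}"
      have "\<forall>i\<in>\<Gamma>. c i = 0"
      proof
        fix i assume "i \<in> \<Gamma>"
        then have "\<not> c i > 0" using \<open>P = {}\<close> by (auto simp: P_def)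
        then show "c i = 0" using c0[of i] by simp
      qed
      then show False using \<open>sum c \<Gamma> = 1\<close> by simp
    qed
    define \<delta> where "\<delta> = Min ((\<lambda>i. s i / c i) ` P)"
    have "\<delta> \<in> (\<lambda>i. s i / c i) ` P" unfolding \<delta>_def using P \<open>P \<noteq> {}\<close> by (intro Min_in) auto
    then obtain k where k: "k \<in> P" "\<delta> = s k / c k" by blast
    have \<delta>0: "\<delta> \<ge> 0" using k by (auto simp: P_def \<Gamma>_def)
    define s' where "s' i = s i - \<delta> * c i" for i
    have le: "\<delta> * c i \<le> s i" if "i \<in> \<Omega>" for i
    proof (cases "i \<in> P")
      case True
      then have "\<delta> \<le> s i / c i" unfolding \<delta>_def using P by (intro Min_le) auto
      then show ?thesis using True by (simp add: P_def field_simps)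
    next
      case False
      then have "c i = 0" using c0[of i] by (auto simp: P_def c_def)
      then show ?thesis using less.prems that by simp
    qed
    have s'0: "s' i \<ge> 0" if "i \<in> \<Omega>" for i using le[OF that] by (simp add: s'_def)
    have "{i\<in>\<Omega>. s' i > 0} \<subset> \<Gamma>"
    proof
      show "{i\<in>\<Omega>. s' i > 0} \<subseteq> \<Gamma>"
      proof clarify
        fix i assume i: "i \<in> \<Omega>" "s' i > 0"
        then show "i \<in> \<Gamma>" using mult_nonneg_nonneg[OF \<delta>0 c0[of i]] by (simp add: \<Gamma>_def s'_def)
      qed
      have "s' k = 0" "k \<in> \<Gamma>" using k by (auto simp: s'_def P_def)
      then show "{i\<in>\<Omega>. s' i > 0} \<noteq> \<Gamma>" by auto
    qed
    then have "card {i\<in>\<Omega>. s' i > 0} < card {i\<in>\<Omega>. s i > 0}"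
      using \<Gamma>(2) unfolding \<Gamma>_def by (rule psubset_card_mono[rotated])
    from less.hyps[OF this s'0]
    have IH: "sum s' \<Omega> - \<kappa> * norm (\<Sum>i\<in>\<Omega>. s' i *\<^sub>R f i) \<le> (\<Sum>i\<in>\<Omega>. s' i * exp (f i \<bullet> x))" .
    have 1: "sum s' \<Omega> = sum s \<Omega> - \<delta>"
      using c1 by (simp add: s'_def sum_subtractf flip: sum_distrib_left)
    have 2: "(\<Sum>i\<in>\<Omega>. s' i *\<^sub>R f i) = (\<Sum>i\<in>\<Omega>. s i *\<^sub>R f i)"
    proof -
      have "(\<Sum>i\<in>\<Omega>. s' i *\<^sub>R f i) = (\<Sum>i\<in>\<Omega>. s i *\<^sub>R f i) - \<delta> *\<^sub>R (\<Sum>i\<in>\<Omega>. c i *\<^sub>R f i)"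
        by (simp add: s'_def scaleR_diff_left sum_subtractf scaleR_sum_right)
      then show ?thesis using cf by simp
    qed
    have 3: "(\<Sum>i\<in>\<Omega>. s' i * exp (f i \<bullet> x)) = (\<Sum>i\<in>\<Omega>. s i * exp (f i \<bullet> x)) - \<delta> * (\<Sum>i\<in>\<Omega>. c i * exp (f i \<bullet> x))"
      by (simp add: s'_def left_diff_distrib sum_subtractf sum_distrib_left mult.assoc)
    have "1 \<le> (\<Sum>i\<in>\<Omega>. c i * exp (f i \<bullet> x))"
    proof -
      have "(\<Sum>i\<in>\<Omega>. c i * (f i \<bullet> x)) = (\<Sum>i\<in>\<Omega>. c i *\<^sub>R f i) \<bullet> x" by (simp add: inner_sum_left)
      then have "1 = (\<Sum>i\<in>\<Omega>. c i * (1 + f i \<bullet> x))"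
        using c1 cf by (simp add: distrib_left sum.distrib)
      also have "\<dots> \<le> (\<Sum>i\<in>\<Omega>. c i * exp (f i \<bullet> x))"
        using c0 exp_ge_add_one_self by (intro sum_mono mult_left_mono) auto
      finally show ?thesis .
    qed
    from mult_left_mono[OF this \<delta>0] show ?thesis using IH unfolding 1 2 3 by simp
  qed
qed

context rational_unitary_rep
begin

text \<open>The mean weight is the diagonal of the moment map after conjugation by the unitary matrix, and
  conjugation preserves the norm. Pairing the mean weight \<open>q\<close> with itself avoids the entries.\<close>
lemma mean_weight_norm_le:
  assumes v: "v \<noteq> 0" and l: "unitary_matrix l"
  shows "norm (\<Sum>\<omega>\<in>weights smul \<pi>. weight_prob (\<pi> l v) \<omega> *\<^sub>R real_vec \<omega>) \<le> norm (moment_map ip \<pi> v)"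
proof -
  define q where "q = (\<Sum>\<omega>\<in>weights smul \<pi>. weight_prob (\<pi> l v) \<omega> *\<^sub>R real_vec \<omega>)"
  let ?H = "cadjoint l ** real_diag q ** cadjoint (cadjoint l)"
  have U: "unitary_matrix (cadjoint l)" using l by simp
  have "q \<bullet> y = (\<Sum>\<omega>\<in>weights smul \<pi>. weight_prob (\<pi> l v) \<omega> * (real_vec \<omega> \<bullet> y))" for y
    by (simp add: q_def inner_sum_left)
  then have "norm q * norm q = moment_map ip \<pi> v \<bullet> ?H"
    using moment_map_pairing[OF v U, of q] by (simp flip: power2_eq_square add: power2_norm_eq_inner)
  also have "\<dots> \<le> norm (moment_map ip \<pi> v) * norm ?H" by (rule norm_cauchy_schwarz)
  also have "norm ?H = norm q" by (rule norm_diagonalized[OF U])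
  finally have "norm q \<le> norm (moment_map ip \<pi> v)"
    by (cases "norm q = 0") (simp_all add: mult_le_cancel_right)
  then show ?thesis by (simp add: q_def)
qed

text \<open>The number \<open>\<kappa>\<close> stands for the reciprocal of the weight margin. After the polar decomposition of
  \<open>g\<close>, the squared norm is an exponential sum over the weights whose first moment is controlled by the
  moment map.\<close>
theorem orbit_norm_lower_bound:
  assumes v: "v \<noteq> 0" and g: "invertible g" and \<kappa>: "\<kappa> \<ge> 0"
    and margin: "\<And>\<Gamma>. \<Gamma> \<noteq> {} \<Longrightarrow> \<Gamma> \<subseteq> weights smul \<pi> \<Longrightarrow> 0 \<notin> convex hull (real_vec ` \<Gamma>) \<Longrightarrow>
      1 \<le> \<kappa> * infdist 0 (convex hull (real_vec ` \<Gamma>))"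
  shows "(ip_norm ip v)\<^sup>2 * (1 - \<kappa> * norm (moment_map ip \<pi> v)) \<le> (ip_norm ip (\<pi> g v))\<^sup>2"
proof -
  obtain k x l where k: "unitary_matrix k" and l: "unitary_matrix l" and g: "g = k ** exp_diag x ** l"
    using invertible_polar_diag[OF g] .
  note inv = unitary_invertible[OF k] unitary_invertible[OF l]
  let ?w = "\<pi> l v"
  have w: "?w \<noteq> 0" by (rule rep_nonzero[OF inv(2) v])
  let ?q = "\<Sum>\<omega>\<in>weights smul \<pi>. weight_prob ?w \<omega> *\<^sub>R real_vec \<omega>"
  have inj: "inj_on real_vec (weights smul \<pi>)" by (rule inj_onI) (simp add: vec_eq_iff)
  have "1 - \<kappa> * norm (moment_map ip \<pi> v) \<le> 1 - \<kappa> * norm ?q"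
    using mean_weight_norm_le[OF v l] \<kappa> by (simp add: mult_left_mono)
  also have "\<dots> \<le> (\<Sum>\<omega>\<in>weights smul \<pi>. weight_prob ?w \<omega> * exp (real_vec \<omega> \<bullet> (2 *\<^sub>R x)))"
    using exponential_sum_lower_bound[OF finite_weights inj \<kappa> margin, of "weight_prob ?w" "2 *\<^sub>R x"]
      weight_prob_nonneg
    by (simp add: weight_prob_sum[OF w])
  finally have "(ip_norm ip v)\<^sup>2 * (1 - \<kappa> * norm (moment_map ip \<pi> v)) \<le> (ip_norm ip ?w)\<^sup>2 *
      (\<Sum>\<omega>\<in>weights smul \<pi>. weight_prob ?w \<omega> * exp (2 * (real_vec \<omega> \<bullet> x)))"
    unfolding rep_unitary_norm[OF l] by (intro mult_left_mono) auto
  also have "\<dots> = (ip_norm ip (\<pi> (exp_diag x) ?w))\<^sup>2" by (rule norm_exp_diag_prob[OF w, symmetric])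
  also have "\<pi> g v = \<pi> k (\<pi> (exp_diag x) ?w)"
    using inv by (simp add: g rep_compose invertible_mult matrix_mul_assoc)
  then have "ip_norm ip (\<pi> (exp_diag x) ?w) = ip_norm ip (\<pi> g v)" by (simp add: rep_unitary_norm[OF k])
  finally show ?thesis .
qed

text \<open>All points of the orbit of \<open>v\<close> lie in the orbit of \<open>\<pi> g v\<close>, so \<open>orbit_norm_lower_bound\<close> bounds
  the capacity from below. It remains to estimate the logarithm: for \<open>0 \<le> z < 1/2\<close> one has
  \<open>- ln (1 - z) / 2 \<le> z\<close>.\<close>
theorem scaling_implies_minimizing:
  assumes cap: "capacity ip \<pi> v > 0" and g: "invertible g" and \<kappa>: "\<kappa> \<ge> 0"
    and margin: "\<And>\<Gamma>. \<Gamma> \<noteq> {} \<Longrightarrow> \<Gamma> \<subseteq> weights smul \<pi> \<Longrightarrow> 0 \<notin> convex hull (real_vec ` \<Gamma>) \<Longrightarrow>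
      1 \<le> \<kappa> * infdist 0 (convex hull (real_vec ` \<Gamma>))"
    and small: "\<epsilon> \<ge> 0" "\<epsilon> * \<kappa> < 1 / 2"
    and moment: "norm (moment_map ip \<pi> (\<pi> g v)) \<le> \<epsilon>"
  shows "ln (ip_norm ip (\<pi> g v)) - ln (capacity ip \<pi> v) \<le> 2 * ln 2 * (\<epsilon> * \<kappa>)"
proof -
  let ?w = "\<pi> g v" and ?c = "capacity ip \<pi> v"
  define z where "z = \<epsilon> * \<kappa>"
  have z: "0 \<le> z" "z < 1 / 2" using small \<kappa> by (simp_all add: z_def)
  have w: "?w \<noteq> 0" by (rule rep_nonzero[OF g capacity_pos_nonzero[OF cap]])
  have n: "ip_norm ip ?w > 0" by (rule norm_pos[OF w])
  obtain g' where g': "g' ** g = mat 1" "g ** g' = mat 1" using g invertible_def by blast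
  have "invertible g'" using g' invertible_def by blast
  have "ip_norm ip ?w * sqrt (1 - z) \<le> ?c"
  proof (rule capacity_greatest)
    fix h :: "complex^'n^'n" assume h: "invertible h"
    have hv: "\<pi> (h ** g') ?w = \<pi> h v"
      using h g \<open>invertible g'\<close> g' by (simp add: rep_compose invertible_mult flip: matrix_mul_assoc)
    have "1 - z \<le> 1 - \<kappa> * norm (moment_map ip \<pi> ?w)"
      using mult_left_mono[OF moment \<kappa>] by (simp add: z_def mult.commute)
    then have "(ip_norm ip ?w)\<^sup>2 * (1 - z) \<le> (ip_norm ip ?w)\<^sup>2 * (1 - \<kappa> * norm (moment_map ip \<pi> ?w))"
      by (intro mult_left_mono) auto
    also have "\<dots> \<le> (ip_norm ip (\<pi> h v))\<^sup>2"
      using orbit_norm_lower_bound[OF w invertible_mult[OF h \<open>invertible g'\<close>] \<kappa> margin]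
      unfolding hv by blast
    finally have "sqrt ((ip_norm ip ?w)\<^sup>2 * (1 - z)) \<le> sqrt ((ip_norm ip (\<pi> h v))\<^sup>2)"
      by (rule real_sqrt_le_mono)
    then show "ip_norm ip ?w * sqrt (1 - z) \<le> ip_norm ip (\<pi> h v)"
      by (simp add: real_sqrt_mult norm_nonneg)
  qed
  then have "ln (ip_norm ip ?w * sqrt (1 - z)) \<le> ln ?c" using n z by (intro ln_mono) auto
  then have 1: "ln (ip_norm ip ?w) + ln (1 - z) / 2 \<le> ln ?c" using n z by (simp add: ln_mult ln_sqrt)
  have "- ln (1 - z) = ln (1 / (1 - z))" using z by (simp add: ln_div)
  also have "\<dots> \<le> 1 / (1 - z) - 1" using z by (intro ln_le_minus_one) auto
  also have "\<dots> = z / (1 - z)" using z by (simp add: field_simps)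
  also have "\<dots> \<le> z / (1 / 2)" using z by (intro divide_left_mono) auto
  finally have "ln (ip_norm ip ?w) - ln ?c \<le> z" using 1 by simp
  also have "z \<le> 2 * ln 2 * z"
    using z ln2_ge_two_thirds mult_right_mono[of 1 "2 * ln 2" z] by simp
  finally show ?thesis by (simp add: z_def)
qed

lemma weight_margin_le:
  assumes "\<Gamma> \<noteq> {}" "\<Gamma> \<subseteq> weights smul \<pi>" "0 \<notin> convex hull (real_vec ` \<Gamma>)"
  shows "weight_margin smul \<pi> \<le> ereal (infdist 0 (convex hull (real_vec ` \<Gamma>)))"
  unfolding weight_margin_def by (rule INF_lower) (use assms in auto)

lemma weight_margin_nonneg: "weight_margin smul \<pi> \<ge> 0"
  unfolding weight_margin_def by (rule INF_greatest) (simp add: infdist_nonneg)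

end

theorem corollary1p18:
  fixes smul :: "complex \<Rightarrow> 'v::ab_group_add \<Rightarrow> 'v"
    and B :: "'v set"
    and ip :: "'v \<Rightarrow> 'v \<Rightarrow> complex"
    and \<pi> :: "complex^'n::{finite,wellorder}^'n::_ \<Rightarrow> 'v \<Rightarrow> 'v"
    and v :: 'v
    and \<epsilon> :: real
    and g :: "complex^'n::_^'n::_"
  assumes "rational_unitary_rep smul B ip \<pi>"
    and "capacity ip \<pi> v > 0"
    and "\<epsilon> > 0"
    and "invertible g"
  shows "(ln (ip_norm ip (\<pi> g v)) - ln (capacity ip \<pi> v) \<le> \<epsilon> \<longrightarrow>
            frobenius_norm (moment_map ip \<pi> (\<pi> g v)) \<le> weight_norm smul \<pi> * sqrt (8 * \<epsilon>))
       \<and> (ereal \<epsilon> / weight_margin smul \<pi> < 1 / 2 \<and>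
          frobenius_norm (moment_map ip \<pi> (\<pi> g v)) \<le> \<epsilon> \<longrightarrow>
            ereal (ln (ip_norm ip (\<pi> g v)) - ln (capacity ip \<pi> v))
              \<le> ereal (2 * ln 2 * \<epsilon>) / weight_margin smul \<pi>)"
proof -
  interpret rational_unitary_rep smul B ip \<pi> by fact
  interpret ordered_rational_unitary_rep smul B ip \<pi> by unfold_locales
  let ?\<gamma> = "weight_margin smul \<pi>" and ?gap = "ln (ip_norm ip (\<pi> g v)) - ln (capacity ip \<pi> v)"
  show ?thesis unfolding frobenius_norm_eq
  proof (intro conjI impI; (elim conjE)?)
    assume "?gap \<le> \<epsilon>"
    then show "norm (moment_map ip \<pi> (\<pi> g v)) \<le> weight_norm smul \<pi> * sqrt (8 * \<epsilon>)"
      by (intro minimizing_implies_scaling[OF assms(2,4)] weight_norm_bound)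
  next
    assume small: "ereal \<epsilon> / ?\<gamma> < 1 / 2" and moment: "norm (moment_map ip \<pi> (\<pi> g v)) \<le> \<epsilon>"
    consider "?\<gamma> = \<infinity>" | r where "?\<gamma> = ereal r" "r \<ge> 0"
      using weight_margin_nonneg by (cases ?\<gamma>) auto
    then show "ereal ?gap \<le> ereal (2 * ln 2 * \<epsilon>) / ?\<gamma>"
    proof cases
      case 1
      \<comment> \<open>The margin is infinite: no \<open>\<Gamma>\<close> avoids the origin, and \<open>\<kappa> = 0\<close> is admissible.\<close>
      have "?gap \<le> 2 * ln 2 * (\<epsilon> * 0)"
      proof (rule scaling_implies_minimizing[OF assms(2,4) order_refl])
        fix \<Gamma> assume "\<Gamma> \<noteq> {}" "\<Gamma> \<subseteq> weights smul \<pi>" "0 \<notin> convex hull (real_vec ` \<Gamma>)"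
        from weight_margin_le[OF this] 1 show "1 \<le> 0 * infdist 0 (convex hull (real_vec ` \<Gamma>))" by simp
      qed (use assms(3) moment in auto)
      then show ?thesis using 1 by (simp flip: zero_ereal_def)
    next
      case 2
      \<comment> \<open>A margin 0 would make the quotient in \<open>small\<close> infinite.\<close>
      have "r \<noteq> 0" using small 2 assms(3) by auto
      then have r: "r > 0" using 2 by simp
      have "?gap \<le> 2 * ln 2 * (\<epsilon> * (1 / r))"
      proof (rule scaling_implies_minimizing[OF assms(2,4)])
        fix \<Gamma> assume "\<Gamma> \<noteq> {}" "\<Gamma> \<subseteq> weights smul \<pi>" "0 \<notin> convex hull (real_vec ` \<Gamma>)"
        from weight_margin_le[OF this] 2 r show "1 \<le> 1 / r * infdist 0 (convex hull (real_vec ` \<Gamma>))" by simp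
      next
        have half: "(1 / 2 :: ereal) = ereal (1 / 2)"
          unfolding one_ereal_def numeral_eq_ereal by simp
        have "ereal (\<epsilon> / r) < ereal (1 / 2)" using small 2 r unfolding half by simp
        then have "\<epsilon> / r < 1 / 2" by (rule less_ereal.simps(1)[THEN iffD1])
        then show "\<epsilon> * (1 / r) < 1 / 2" by simp
      qed (use assms(3) moment r in auto)
      then show ?thesis using 2 r by simp
    qed
  qed
qed

end
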